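(* Let $p$ be a prime and suppose $A\subset\mathbb{F}_p^{*}$ with $|A|\leq p^{1/2}$. Then $$\Big|\frac{A+1}{A}\Big|\gtrsim|A|^{110/109},$$ where $\frac{A+1}{A}=\{(a+1)/b: a,b\in A\}$.
   Context: $X\gtrsim Y$ means $X\ge cY$ for an absolute constant $c>0$. *)

theory Defs
  imports "HOL-Analysis.Analysis" "HOL-Number_Theory.Residues"
begin

definition shifted_ratio_set :: "('a, 'b) ring_scheme \<Rightarrow> 'a set \<Rightarrow> 'a set"
  where "shifted_ratio_set R A =
    {(a \<oplus>\<^bsub>R\<^esub> \<one>\<^bsub>R\<^esub>) \<otimes>\<^bsub>R\<^esub> inv\<^bsub>R\<^esub> b | a b. a \<in> A \<and> b \<in> A}"

end

theory Submission
  imports Defs "HOL-Library.Set_Algebras"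
begin

text \<open>
  Put \<open>B = A + 1\<close>, \<open>D = 1/A\<close>, \<open>n = |A|\<close> and \<open>|BD| = K n\<close>; Ruzsa's triangle inequality gives
  \<open>|AD| \<le> K\<^sup>2 n\<close>. The identity \<open>(a + 1) x - a x = x\<close> shows that every \<open>x \<in> D\<close> has \<open>n\<close>
  representations as a difference of an element of \<open>BD\<close> and an element of \<open>AD\<close>, so a
  Balog--Szemeredi--Gowers argument yields \<open>C \<subseteq> D\<close> with \<open>|C| \<ge> n/(4K)\<close> and
  \<open>|C - C| = O(K\<^sup>1\<^sup>1 n)\<close>, while \<open>|C/C| \<le> K\<^sup>2 n\<close>.

  Such a \<open>C\<close> contradicts the sum-product phenomenon unless \<open>K\<close> is large. Many products \<open>c x\<close> with
  \<open>c, x \<in> C\<close> fall into one dilate \<open>a\<^sub>0 C\<close>; pass to \<open>S \<subseteq> C\<close> on which this graph has large minimum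
  degree. For \<open>r = (a - b)/(c - d)\<close> with \<open>a, b, c, d \<in> S\<close>, Pluennecke's inequality bounds
  \<open>|X + r Y|\<close> for large subsets \<open>X\<close>, \<open>Y\<close> of \<open>S\<close>. If these \<open>r\<close> exhaust the field, some \<open>r\<close> makes
  the additive energy of \<open>C\<close> and \<open>r C\<close> minimal; otherwise some \<open>r\<close> has \<open>r - 1\<close> outside the set, and
  then \<open>(x, y) \<mapsto> x + (r - 1) y\<close> is injective on \<open>S \<times> S\<close>. Both cases give \<open>n \<le> O(K\<^sup>1\<^sup>0\<^sup>0)\<close>, which is
  stronger than the exponent \<open>110/109\<close>.
\<close>

section \<open>Sumsets in abelian groups\<close>

text \<open>Encoded as a sumset with the negated second set, so that Pluennecke bounds for sumsets
  apply to differences by unfolding.\<close>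

definition diff_set :: "'a::ab_group_add set \<Rightarrow> 'a set \<Rightarrow> 'a set"
  where "diff_set X Y = X + uminus ` Y"

lemma mem_diff_set: "z \<in> diff_set X Y \<longleftrightarrow> (\<exists>x\<in>X. \<exists>y\<in>Y. z = x - y)"
  by (simp add: diff_set_def set_plus_def)

lemma diff_setI [intro]: "x \<in> X \<Longrightarrow> y \<in> Y \<Longrightarrow> x - y \<in> diff_set X Y"
  by (auto simp: mem_diff_set)

lemma finite_diff_set [intro, simp]: "finite X \<Longrightarrow> finite Y \<Longrightarrow> finite (diff_set X Y)"
  by (simp add: diff_set_def finite_set_plus)

lemma diff_set_mono: "X \<subseteq> X' \<Longrightarrow> Y \<subseteq> Y' \<Longrightarrow> diff_set X Y \<subseteq> diff_set X' Y'"
  by (fastforce simp: mem_diff_set)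

section \<open>Ruzsa's triangle inequality and Pluennecke's inequality\<close>

text \<open>Fix one representation \<open>d = f d - g d\<close> of each difference. The pair
  \<open>(x - f d, x - g d)\<close> determines \<open>d\<close> as the difference of its
  coordinates, and then \<open>x\<close>.\<close>

lemma ruzsa_triangle:
  fixes X Y Z :: "'a::ab_group_add set"
  assumes "finite X" "finite Y" "finite Z"
  shows "card X * card (diff_set Y Z) \<le> card (diff_set X Y) * card (diff_set X Z)"
proof -
  have "\<forall>d\<in>diff_set Y Z. \<exists>y. y \<in> Y \<and> (\<exists>z\<in>Z. d = y - z)"
    by (simp add: mem_diff_set Bex_def)
  from bchoice[OF this] obtain f where f: "\<forall>d\<in>diff_set Y Z. f d \<in> Y \<and> (\<exists>z\<in>Z. d = f d - z)"
    by blast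
  then have "\<forall>d\<in>diff_set Y Z. \<exists>z. z \<in> Z \<and> d = f d - z"
    by blast
  from bchoice[OF this] f obtain g
    where fg: "\<And>d. d \<in> diff_set Y Z \<Longrightarrow> f d \<in> Y \<and> g d \<in> Z \<and> d = f d - g d"
    by blast
  define \<phi> where "\<phi> = (\<lambda>(x, d). (x - f d, x - g d))"
  have "inj_on \<phi> (X \<times> diff_set Y Z)"
  proof (rule inj_onI, clarify)
    fix x d x' d'
    assume d: "d \<in> diff_set Y Z" "d' \<in> diff_set Y Z" and eq: "\<phi> (x, d) = \<phi> (x', d')"
    then have e: "x - f d = x' - f d'" "x - g d = x' - g d'"
      by (auto simp: \<phi>_def)
    have "d = (x - g d) - (x - f d)"
      using fg[OF d(1)] by (simp add: algebra_simps)
    also have "\<dots> = (x' - g d') - (x' - f d')"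
      by (simp only: e)
    also have "\<dots> = d'"
      using fg[OF d(2)] by (simp add: algebra_simps)
    finally show "x = x' \<and> d = d'" using e by simp
  qed
  moreover have "\<phi> ` (X \<times> diff_set Y Z) \<subseteq> diff_set X Y \<times> diff_set X Z"
    using fg by (fastforce simp: \<phi>_def mem_diff_set)
  ultimately have "card (X \<times> diff_set Y Z) \<le> card (diff_set X Y \<times> diff_set X Z)"
    using assms by (intro card_inj_on_le[of \<phi>]) auto
  then show ?thesis by (simp add: card_cartesian_product)
qed

text \<open>Petridis' proof of Pluennecke's inequality. Minimising a weighted sum over all
  summands \<open>T\<close> makes one and the same \<open>X\<close> work for each of them.\<close>

lemma plunnecke_petridis:
  fixes Z :: "'a::ab_group_add set"
  assumes Z: "finite Z" "Z \<noteq> {}" and \<T>: "finite \<T>" "\<And>T. T \<in> \<T> \<Longrightarrow> finite T"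
  obtains X where "X \<subseteq> Z" "X \<noteq> {}"
    "\<And>T C. T \<in> \<T> \<Longrightarrow> finite C \<Longrightarrow>
      card Z * card (X + T + C) \<le> card \<T> * card (Z + T) * card (X + C)"
proof -
  \<comment> \<open>The weights normalise by the growth of \<open>Z + T\<close>, so every
    \<open>T\<close> contributes at most \<open>card Z\<close> to \<open>f Z\<close>. Hence the
    minimal ratio is at most \<open>card \<T>\<close>.\<close>
  define w where "w T = real (card Z) / real (card (Z + T))" for T
  define f where "f X = (\<Sum>T\<in>\<T>. w T * real (card (X + T)))" for X
  define r where "r X = f X / real (card X)" for X
  have w0: "w T \<ge> 0" for T by (simp add: w_def)
  obtain X where "is_arg_min r (\<lambda>X. X \<in> Pow Z - {{}}) X"
    using ex_is_arg_min_if_finite[of "Pow Z - {{}}" r] Z by auto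
  then have X: "X \<subseteq> Z" "X \<noteq> {}" and min: "\<And>X'. X' \<subseteq> Z \<Longrightarrow> X' \<noteq> {} \<Longrightarrow> r X \<le> r X'"
    by (auto simp: is_arg_min_linorder)
  have finX: "finite X" using X Z finite_subset by blast
  have cX: "card X > 0" using X finX by (simp add: card_gt_0_iff)
  have cZ: "card Z > 0" using Z by (simp add: card_gt_0_iff)
  have fX: "f X = r X * real (card X)" using cX by (simp add: r_def)
  have lower: "r X * real (card X') \<le> f X'" if "X' \<subseteq> X" for X'
  proof (cases "X' = {}")
    case False
    have "finite X'" using that finX finite_subset by blast
    then have "card X' > 0" using False by (simp add: card_gt_0_iff)
    moreover have "r X \<le> r X'" using min[of X'] that X False by blast
    ultimately show ?thesis by (simp add: r_def[of X'] field_simps)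
  qed (auto simp: f_def intro!: sum_nonneg mult_nonneg_nonneg w0)
  have rX: "r X \<le> real (card \<T>)"
  proof -
    have "r X \<le> f Z / real (card Z)" using min[of Z] Z by (simp add: r_def)
    also have "f Z \<le> (\<Sum>T\<in>\<T>. real (card Z))"
      unfolding f_def by (intro sum_mono) (auto simp: w_def)
    then have "f Z / real (card Z) \<le> real (card \<T>)"
      using cZ by (simp add: field_simps)
    finally show ?thesis .
  qed
  \<comment> \<open>On passing to \<open>insert c C\<close>, the part of \<open>X + c\<close>
    already covered is \<open>X' + c\<close>, and then \<open>X' + T + c\<close> is already covered
    by \<open>X + T + C\<close>. By minimality of \<open>r X\<close> the weighted saving is at least
    \<open>r X * card X'\<close>.\<close>
  have key: "(\<Sum>T\<in>\<T>. w T * real (card (X + T + C))) \<le> r X * real (card (X + C))" if "finite C" for C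
    using that
  proof (induction C rule: finite_induct)
    case empty
    then show ?case by simp
  next
    case (insert c C)
    define X' where "X' = {x \<in> X. x + c \<in> X + C}"
    have X': "X' \<subseteq> X" by (auto simp: X'_def)
    have finX': "finite X'" using X' finX finite_subset by blast
    have ins: "S + insert c C = (S + C) \<union> (\<lambda>s. s + c) ` S" for S :: "'a set"
      by (auto simp: set_plus_def)
    have cim: "card ((\<lambda>s. s + c) ` S) = card S" for S :: "'a set"
      by (simp add: card_image)
    have eq: "card (X + insert c C) + card X' = card (X + C) + card X"
    proof -
      have "(X + C) \<inter> (\<lambda>s. s + c) ` X = (\<lambda>s. s + c) ` X'"
        by (auto simp: X'_def)
      then show ?thesis
        using card_Un_Int[of "X + C" "(\<lambda>s. s + c) ` X"] finX insert.hyps(1)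
        by (simp add: ins cim finite_set_plus)
    qed
    have le: "card (X + T + insert c C) + card (X' + T) \<le> card (X + T + C) + card (X + T)"
      if "T \<in> \<T>" for T
    proof -
      have finT: "finite T" using \<T> that by blast
      have "(\<lambda>s. s + c) ` (X' + T) \<subseteq> (X + T + C) \<inter> (\<lambda>s. s + c) ` (X + T)"
      proof clarify
        fix s assume "s \<in> X' + T"
        then obtain x t where xt: "s = x + t" "x \<in> X'" "t \<in> T" by (auto elim: set_plus_elim)
        then obtain y d where "x + c = y + d" "y \<in> X" "d \<in> C" by (auto simp: X'_def elim: set_plus_elim)
        then have "s + c = y + t + d" using xt by (metis add.assoc add.commute)
        then have "s + c \<in> X + T + C"
          using \<open>y \<in> X\<close> \<open>d \<in> C\<close> xt(3) by (simp only: set_plus_intro)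
        moreover have "s \<in> X + T" using xt X' by auto
        ultimately show "s + c \<in> (X + T + C) \<inter> (\<lambda>s. s + c) ` (X + T)" by blast
      qed
      then have "card (X' + T) \<le> card ((X + T + C) \<inter> (\<lambda>s. s + c) ` (X + T))"
        using finX finT by (metis cim card_mono finite_Int finite_imageI finite_set_plus)
      then show ?thesis
        using card_Un_Int[of "X + T + C" "(\<lambda>s. s + c) ` (X + T)"] finX insert.hyps(1) finT
        by (simp add: ins cim finite_set_plus)
    qed
    have "(\<Sum>T\<in>\<T>. w T * real (card (X + T + insert c C))) + f X'
        = (\<Sum>T\<in>\<T>. w T * real (card (X + T + insert c C) + card (X' + T)))"
      by (simp add: f_def sum.distrib algebra_simps)
    also have "\<dots> \<le> (\<Sum>T\<in>\<T>. w T * real (card (X + T + C) + card (X + T)))"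
      by (intro sum_mono mult_left_mono w0) (use le in \<open>simp only: of_nat_le_iff\<close>)
    also have "\<dots> = (\<Sum>T\<in>\<T>. w T * real (card (X + T + C))) + f X"
      by (simp add: f_def sum.distrib algebra_simps)
    also have "\<dots> \<le> r X * real (card (X + C)) + r X * real (card X)"
      using insert.IH fX by simp
    also have "\<dots> = r X * real (card (X + insert c C)) + r X * real (card X')"
      using arg_cong[OF eq, of "\<lambda>k. r X * real k"] by (simp add: algebra_simps)
    finally show ?case using lower[OF X'] by linarith
  qed
  show thesis
  proof (rule that[OF X])
    fix T C :: "'a set" assume T: "T \<in> \<T>" and C: "finite C"
    show "card Z * card (X + T + C) \<le> card \<T> * card (Z + T) * card (X + C)"
    proof (cases "T = {}")
      \<comment> \<open>Here the weight is 0 by division by zero, so the weighted sum carries no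
        information about \<open>T\<close>.\<close>
      case True
      then have "X + T + C = {}" by (auto simp: set_plus_def)
      then show ?thesis by simp
    next
      case False
      then have "Z + T \<noteq> {}" using Z by (auto simp: set_plus_def)
      moreover have "finite (Z + T)" using Z \<T> T by (simp add: finite_set_plus)
      ultimately have cZT: "card (Z + T) > 0" by (simp add: card_gt_0_iff)
      have "w T * real (card (X + T + C)) \<le> (\<Sum>T\<in>\<T>. w T * real (card (X + T + C)))"
        by (rule member_le_sum[OF T]) (use w0 \<T>(1) in auto)
      also have "\<dots> \<le> r X * real (card (X + C))" by (rule key[OF C])
      also have "\<dots> \<le> real (card \<T>) * real (card (X + C))"
        using rX by (intro mult_right_mono) auto
      finally have "real (card Z * card (X + T + C)) \<le> real (card \<T> * card (Z + T) * card (X + C))"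
        using cZT by (simp add: w_def field_simps)
      then show ?thesis by (simp only: of_nat_le_iff)
    qed
  qed
qed

section \<open>Double counting and the Balog-Szemeredi-Gowers argument\<close>

text \<open>Fibres over distinct points are disjoint. With \<open>f\<close> a difference of
  coordinates this turns many representations of each element of \<open>P\<close> into an upper
  bound for \<open>card P\<close>.\<close>

lemma card_mult_le_if_fibres_ge:
  fixes t :: real
  assumes "finite S" "finite P" "\<And>q. q \<in> P \<Longrightarrow> t \<le> real (card {s \<in> S. f s = q})"
  shows "real (card P) * t \<le> real (card S)"
proof -
  have "real (card P) * t \<le> (\<Sum>q\<in>P. real (card {s \<in> S. f s = q}))"
    using sum_mono[of P "\<lambda>_. t"] assms(3) by simp
  also have "\<dots> = real (card (\<Union>q\<in>P. {s \<in> S. f s = q}))"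
    using assms by (subst card_UN_disjoint) auto
  also have "\<dots> \<le> real (card S)"
    using assms by (intro of_nat_mono card_mono) auto
  finally show ?thesis .
qed

text \<open>The neighbourhood of a random \<open>u \<in> U\<close> in the graph \<open>u \<in> N x\<close> contains few pairs with
  small common neighbourhood; \<open>C\<close> consists of its points that lie in few such pairs.
  Every difference of \<open>C\<close> then has many representations as a sum of four signed elements of \<open>V\<close>.\<close>

lemma balog_szemeredi_gowers_pivot:
  fixes D U V :: "'a::ab_group_add set" and N :: "'a \<Rightarrow> 'a set"
  assumes fin: "finite D" "finite U" "finite V" and "D \<noteq> {}"
    and NU: "\<And>x. x \<in> D \<Longrightarrow> N x \<subseteq> U"
    and cardN: "\<And>x. x \<in> D \<Longrightarrow> card (N x) = card D"
    and NV: "\<And>x u. x \<in> D \<Longrightarrow> u \<in> N x \<Longrightarrow> u - x \<in> V"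
  obtains C where "C \<subseteq> D" "card D ^ 2 \<le> 4 * card U * card C"
    "card (diff_set C C) * card D ^ 6 \<le> 1024 * card U ^ 3 * card V ^ 4"
proof -
  define n q where "n = real (card D)" and "q = real (card U)"
  have n: "n > 0" using assms by (simp add: n_def card_gt_0_iff)
  obtain x0 where "x0 \<in> D" using \<open>D \<noteq> {}\<close> by blast
  then have "card D \<le> card U" using NU cardN fin by (metis card_mono)
  then have q: "q > 0" using n by (simp add: n_def q_def)
  define nb where "nb u = {x \<in> D. u \<in> N x}" for u
  \<comment> \<open>By Cauchy-Schwarz the mean of \<open>card (N x \<inter> N y)\<close> over all
    pairs is at least \<open>n^2 / q\<close>; \<open>good\<close> asks for one sixteenth of
    it.\<close>
  define good where "good x y \<longleftrightarrow> n^2 / (16 * q) \<le> real (card (N x \<inter> N y))" for x y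
  define bad where "bad u = {(x, y). x \<in> nb u \<and> y \<in> nb u \<and> \<not> good x y}" for u
  define deg where "deg u = real (card (nb u))" for u
  have good_sym: "good x y \<longleftrightarrow> good y x" for x y by (simp add: good_def Int_commute)
  have fin_nb: "finite (nb u)" for u using fin by (simp add: nb_def)
  have finN: "finite (N x)" if "x \<in> D" for x using NU that fin finite_subset by blast
  have bad_sub: "bad u \<subseteq> nb u \<times> nb u" for u by (auto simp: bad_def)
  have fin_bad: "finite (bad u)" for u using bad_sub fin_nb by (meson finite_SigmaI finite_subset)
  have card_filter: "real (card {x \<in> S. P x}) = (\<Sum>x\<in>S. of_bool (P x))" if "finite S" for S and P :: "'b \<Rightarrow> bool"
    using that by (simp add: sum.If_cases of_bool_def Int_def)
  have sum_deg: "(\<Sum>u\<in>U. deg u) = n^2"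
  proof -
    have "(\<Sum>u\<in>U. deg u) = (\<Sum>u\<in>U. \<Sum>x\<in>D. of_bool (u \<in> N x))"
      using fin by (simp add: deg_def nb_def card_filter)
    also have "\<dots> = (\<Sum>x\<in>D. \<Sum>u\<in>U. of_bool (u \<in> N x))" by (rule sum.swap)
    also have "\<dots> = (\<Sum>x\<in>D. real (card {u \<in> U. u \<in> N x}))"
      using fin by (simp add: card_filter)
    also have "\<dots> = (\<Sum>x\<in>D. n)"
    proof (rule sum.cong[OF refl])
      fix x assume "x \<in> D"
      then have "{u \<in> U. u \<in> N x} = N x" using NU by blast
      then show "real (card {u \<in> U. u \<in> N x}) = n" using cardN \<open>x \<in> D\<close> by (simp add: n_def)
    qed
    finally show ?thesis by (simp add: n_def power2_eq_square)
  qed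
  have cs: "n^4 \<le> q * (\<Sum>u\<in>U. (deg u)^2)"
  proof -
    have "(\<Sum>u\<in>U. deg u)^2 \<le> (\<Sum>u\<in>U. (deg u)^2) * q"
      using sum_squared_le_sum_of_squares[of deg U] by (simp add: q_def)
    then show ?thesis by (simp add: sum_deg mult.commute)
  qed
  have sum_bad: "(\<Sum>u\<in>U. real (card (bad u))) \<le> n^4 / (16 * q)"
  proof -
    define G where "G = {(x, y). x \<in> D \<and> y \<in> D \<and> \<not> good x y}"
    have GD: "G \<subseteq> D \<times> D" by (auto simp: G_def)
    then have finG: "finite G" using fin by (meson finite_SigmaI finite_subset)
    have "(\<Sum>u\<in>U. real (card (bad u))) = (\<Sum>u\<in>U. \<Sum>z\<in>G. of_bool (u \<in> N (fst z) \<inter> N (snd z)))"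
    proof (rule sum.cong[OF refl])
      fix u
      have "bad u = {z \<in> G. u \<in> N (fst z) \<inter> N (snd z)}"
        by (auto simp: bad_def nb_def G_def)
      then show "real (card (bad u)) = (\<Sum>z\<in>G. of_bool (u \<in> N (fst z) \<inter> N (snd z)))"
        by (simp only: card_filter[OF finG])
    qed
    also have "\<dots> = (\<Sum>z\<in>G. \<Sum>u\<in>U. of_bool (u \<in> N (fst z) \<inter> N (snd z)))" by (rule sum.swap)
    also have "\<dots> \<le> (\<Sum>z\<in>G. n^2 / (16 * q))"
    proof (rule sum_mono)
      fix z assume "z \<in> G"
      then have z: "fst z \<in> D" "\<not> good (fst z) (snd z)" by (auto simp: G_def)
      have "(\<Sum>u\<in>U. of_bool (u \<in> N (fst z) \<inter> N (snd z))) = real (card {u \<in> U. u \<in> N (fst z) \<inter> N (snd z)})"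
        by (rule card_filter[OF fin(2), symmetric])
      also have "{u \<in> U. u \<in> N (fst z) \<inter> N (snd z)} = N (fst z) \<inter> N (snd z)" using NU z by blast
      finally show "(\<Sum>u\<in>U. of_bool (u \<in> N (fst z) \<inter> N (snd z))) \<le> n^2 / (16 * q)"
        using z(2) by (simp add: good_def)
    qed
    also have "\<dots> = real (card G) * (n^2 / (16 * q))" by simp
    also have "\<dots> \<le> n^2 * (n^2 / (16 * q))"
    proof (rule mult_right_mono)
      have "card G \<le> card (D \<times> D)" using GD fin by (intro card_mono) auto
      then show "real (card G) \<le> n^2"
        by (simp add: n_def card_cartesian_product power2_eq_square flip: of_nat_mult)
    qed (use q in simp)
    finally show ?thesis by (simp add: power_def numeral_eq_Suc)
  qed
  \<comment> \<open>Averaging over \<open>U\<close>: the left sides sum to at least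
    \<open>n^4 / q - n^4 / (2 * q)\<close>. This single inequality bounds \<open>deg u\<close> from
    below and also gives at most \<open>(deg u)^2 / 8\<close> bad pairs.\<close>
  obtain u where u: "(deg u)^2 - 8 * real (card (bad u)) \<ge> n^4 / (2 * q^2)"
  proof (rule ccontr)
    assume "\<not> thesis"
    then have less: "(deg u)^2 - 8 * real (card (bad u)) < n^4 / (2 * q^2)" for u
      using that by (meson not_le)
    have "n^4 / q - 8 * (n^4 / (16 * q)) \<le> (\<Sum>u\<in>U. (deg u)^2) - 8 * (\<Sum>u\<in>U. real (card (bad u)))"
      using cs sum_bad q by (intro diff_mono mult_left_mono) (auto simp: field_simps)
    also have "\<dots> = (\<Sum>u\<in>U. (deg u)^2 - 8 * real (card (bad u)))"
      by (simp add: sum_subtractf sum_distrib_left)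
    also have "\<dots> < (\<Sum>u\<in>U. n^4 / (2 * q^2))"
      using less fin q by (intro sum_strict_mono) (auto simp: q_def)
    also have "\<dots> = n^4 / q - 8 * (n^4 / (16 * q))"
      using q by (simp add: q_def[symmetric] field_simps power2_eq_square)
    finally show False by simp
  qed
  have deg0: "deg u \<ge> 0" by (simp add: deg_def)
  have "(n^2 / (2 * q))^2 \<le> n^4 / (2 * q^2)"
    using n q by (simp add: field_simps power2_eq_square) (simp add: power_def numeral_eq_Suc)
  also have "\<dots> \<le> (deg u)^2" using u by simp
  finally have deg_ge: "n^2 / (2 * q) \<le> deg u"
    using deg0 by (rule power2_le_imp_le)
  moreover have "n^2 / (2 * q) > 0" using n q by simp
  ultimately have degpos: "deg u > 0" by linarith
  have "n^4 / (2 * q^2) \<ge> 0" using n q by simp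
  then have bad_le: "8 * real (card (bad u)) \<le> (deg u)^2" using u by linarith
  define C where "C = {x \<in> nb u. real (card {y \<in> nb u. \<not> good x y}) \<le> deg u / 4}"
  have CD: "C \<subseteq> D" by (auto simp: C_def nb_def)
  have finC: "finite C" using CD fin finite_subset by blast
  have C_nb: "C \<subseteq> nb u" by (auto simp: C_def)
  \<comment> \<open>Each discarded point is the first coordinate of more than
    \<open>deg u / 4\<close> bad pairs, so at most half of \<open>nb u\<close> is discarded.\<close>
  have "real (card (nb u - C)) * (deg u / 4) \<le> real (card (bad u))"
  proof (rule card_mult_le_if_fibres_ge[where f = fst])
    fix x assume x: "x \<in> nb u - C"
    have "{z \<in> bad u. fst z = x} = Pair x ` {y \<in> nb u. \<not> good x y}"
      using x by (auto simp: bad_def)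
    then have "card {z \<in> bad u. fst z = x} = card {y \<in> nb u. \<not> good x y}"
      by (simp add: card_image inj_on_def)
    then show "deg u / 4 \<le> real (card {z \<in> bad u. fst z = x})"
      using x by (auto simp: C_def)
  qed (use fin_bad fin_nb in auto)
  then have "real (card (nb u - C)) * deg u \<le> deg u / 2 * deg u"
    using bad_le by (simp add: power2_eq_square)
  then have "real (card (nb u - C)) \<le> deg u / 2" using degpos by simp
  moreover have "card (nb u) = card (nb u - C) + card C"
    using fin_nb C_nb finC by (simp add: card_Diff_subset card_mono)
  ultimately have cardC: "deg u / 2 \<le> real (card C)" by (simp add: deg_def)
  define P where "P = {x - y | x y. x \<in> D \<and> y \<in> D \<and> good x y}"
  have "P \<subseteq> diff_set D D" by (auto simp: P_def)
  then have finP: "finite P" using fin finite_subset finite_diff_set by blast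
  \<comment> \<open>Every \<open>w \<in> N x \<inter> N y\<close> gives
    \<open>x - y = (w - y) - (w - x)\<close> with both differences in \<open>V\<close>.\<close>
  have cardP: "real (card P) * (n^2 / (16 * q)) \<le> real (card (V \<times> V))"
  proof (rule card_mult_le_if_fibres_ge[where f = "\<lambda>(v, v'). v' - v"])
    fix z assume "z \<in> P"
    then obtain x y where xy: "z = x - y" "x \<in> D" "y \<in> D" "good x y" by (auto simp: P_def)
    have "card (N x \<inter> N y) \<le> card {s \<in> V \<times> V. (case s of (v, v') \<Rightarrow> v' - v) = z}"
      by (rule card_inj_on_le[where f = "\<lambda>w. (w - x, w - y)"])
         (use xy NV fin in \<open>auto simp: inj_on_def\<close>)
    then show "n^2 / (16 * q) \<le> real (card {s \<in> V \<times> V. (case s of (v, v') \<Rightarrow> v' - v) = z})"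
      using xy(4) unfolding good_def by linarith
  qed (use fin finP in auto)
  \<comment> \<open>For \<open>x, y \<in> C\<close> at most half of the points of
    \<open>nb u\<close> fail to be good with \<open>x\<close> or with \<open>y\<close>. Each
    remaining \<open>w\<close> gives \<open>x - y = (x - w) - (y - w)\<close> with both differences
    in \<open>P\<close>.\<close>
  have cardCC: "real (card (diff_set C C)) * (deg u / 2) \<le> real (card (P \<times> P))"
  proof (rule card_mult_le_if_fibres_ge[where f = "\<lambda>(v, v'). v - v'"])
    fix z assume "z \<in> diff_set C C"
    then obtain x y where xy: "z = x - y" "x \<in> C" "y \<in> C" by (auto simp: mem_diff_set)
    define W where "W = {w \<in> nb u. good x w \<and> good y w}"
    have "nb u = W \<union> ({w \<in> nb u. \<not> good x w} \<union> {w \<in> nb u. \<not> good y w})"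
      by (auto simp: W_def)
    then have "card (nb u) \<le> card W + (card {w \<in> nb u. \<not> good x w} + card {w \<in> nb u. \<not> good y w})"
      by (metis (no_types, lifting) card_Un_le add_left_mono order_trans)
    moreover have "real (card {w \<in> nb u. \<not> good x w}) \<le> deg u / 4" "real (card {w \<in> nb u. \<not> good y w}) \<le> deg u / 4"
      using xy by (auto simp: C_def)
    ultimately have "deg u / 2 \<le> real (card W)" unfolding deg_def by linarith
    also have "card W \<le> card {s \<in> P \<times> P. (case s of (v, v') \<Rightarrow> v - v') = z}"
    proof (rule card_inj_on_le[where f = "\<lambda>w. (x - w, y - w)"])
      show "(\<lambda>w. (x - w, y - w)) ` W \<subseteq> {s \<in> P \<times> P. (case s of (v, v') \<Rightarrow> v - v') = z}"
        using xy CD by (auto simp: W_def P_def nb_def)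
    qed (use finP in \<open>auto simp: inj_on_def\<close>)
    finally show "deg u / 2 \<le> real (card {s \<in> P \<times> P. (case s of (v, v') \<Rightarrow> v - v') = z})"
      by simp
  qed (use finC finP in auto)
  show thesis
  proof (rule that[OF CD])
    have "n^2 / (2 * q) \<le> 2 * real (card C)" using deg_ge cardC by linarith
    then have "n^2 \<le> 4 * q * real (card C)" using q by (simp add: field_simps)
    then have "real (card D ^ 2) \<le> real (4 * card U * card C)" by (simp add: n_def q_def)
    then show "card D ^ 2 \<le> 4 * card U * card C" by (simp only: of_nat_le_iff)
    define v r \<Delta> where "v = real (card V)" and "r = real (card P)" and "\<Delta> = real (card (diff_set C C))"
    have "r * n^2 \<le> 16 * q * v^2"
      using cardP q by (simp add: r_def v_def card_cartesian_product field_simps power2_eq_square)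
    then have r2: "(r * n^2)^2 \<le> (16 * q * v^2)^2"
      by (intro power_mono) (auto simp: r_def)
    have "\<Delta> * (n^2 / (2 * q) / 2) \<le> \<Delta> * (deg u / 2)"
      using deg_ge by (intro mult_left_mono) (auto simp: \<Delta>_def)
    also have "\<dots> \<le> r^2" using cardCC by (simp add: \<Delta>_def r_def card_cartesian_product power2_eq_square)
    finally have "\<Delta> * n^2 \<le> 4 * q * r^2" using q by (simp add: field_simps)
    then have "\<Delta> * n^2 * n^4 \<le> 4 * q * r^2 * n^4" by (intro mult_right_mono) auto
    also have "\<dots> = 4 * q * (r * n^2)^2" by (simp add: power_mult_distrib flip: power_mult)
    also have "\<dots> \<le> 4 * q * (16 * q * v^2)^2" using r2 q by (intro mult_left_mono) auto
    also have "\<dots> = 1024 * q^3 * v^4" by (simp add: power_mult_distrib power3_eq_cube power2_eq_square power4_eq_xxxx)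
    finally have "\<Delta> * n^6 \<le> 1024 * q^3 * v^4"
      by (simp add: mult.assoc flip: power_add)
    then have "real (card (diff_set C C) * card D ^ 6) \<le> real (1024 * card U ^ 3 * card V ^ 4)"
      by (simp add: \<Delta>_def n_def q_def v_def)
    then show "card (diff_set C C) * card D ^ 6 \<le> 1024 * card U ^ 3 * card V ^ 4"
      by (simp only: of_nat_le_iff)
  qed
qed

section \<open>Collision counting and subgraphs of large minimum degree\<close>

text \<open>Cauchy-Schwarz for the fibre sizes of \<open>f\<close>: they sum to
  \<open>card S\<close>, and their squares sum to the number of colliding pairs.\<close>

lemma card_sq_le_collisions:
  assumes S: "finite S" and Q: "finite Q" "f ` S \<subseteq> Q"
  shows "real (card S) ^ 2 \<le> real (card Q) * real (card {(s, t). s \<in> S \<and> t \<in> S \<and> f s = f t})"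
proof -
  define fib where "fib q = {s \<in> S. f s = q}" for q
  have fin: "finite (fib q)" for q using S by (simp add: fib_def)
  have "S = (\<Union>q\<in>Q. fib q)" using Q by (auto simp: fib_def)
  then have "card S = card (\<Union>q\<in>Q. fib q)" by simp
  also have "\<dots> = (\<Sum>q\<in>Q. card (fib q))"
    using Q fin by (intro card_UN_disjoint) (auto simp: fib_def)
  finally have sum1: "real (card S) = (\<Sum>q\<in>Q. real (card (fib q)))" by simp
  have "{(s, t). s \<in> S \<and> t \<in> S \<and> f s = f t} = (\<Union>q\<in>Q. fib q \<times> fib q)"
    using Q by (auto simp: fib_def)
  then have "card {(s, t). s \<in> S \<and> t \<in> S \<and> f s = f t} = card (\<Union>q\<in>Q. fib q \<times> fib q)" by simp
  also have "\<dots> = (\<Sum>q\<in>Q. card (fib q \<times> fib q))"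
    using Q fin by (intro card_UN_disjoint) (auto simp: fib_def)
  finally have sum2: "real (card {(s, t). s \<in> S \<and> t \<in> S \<and> f s = f t}) = (\<Sum>q\<in>Q. (real (card (fib q)))^2)"
    by (simp add: card_cartesian_product power2_eq_square)
  show ?thesis
    unfolding sum1 sum2 using sum_squared_le_sum_of_squares[of "\<lambda>q. real (card (fib q))" Q]
    by (simp add: mult.commute)
qed

text \<open>Take a smallest non-empty subset that keeps edge density \<open>t\<close>. Deleting a
  vertex of degree below \<open>t / 2\<close> loses fewer than \<open>t\<close> ordered edges, so
  the density would survive; it would do so strictly, hence the smaller set would still be
  non-empty.\<close>

lemma min_degree_subset:
  fixes t :: real
  assumes C: "finite C" "C \<noteq> {}" and sym: "\<And>x y. E x y \<Longrightarrow> E y x" and t: "t > 0"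
    and edges: "t * real (card C) \<le> real (card {(x, y). x \<in> C \<and> y \<in> C \<and> E x y})"
  obtains S where "S \<subseteq> C" "S \<noteq> {}" "\<And>x. x \<in> S \<Longrightarrow> t / 2 \<le> real (card {y \<in> S. E x y})"
proof -
  define edg where "edg S = {(x, y). x \<in> S \<and> y \<in> S \<and> E x y}" for S
  define \<S> where "\<S> = {S \<in> Pow C. S \<noteq> {} \<and> t * real (card S) \<le> real (card (edg S))}"
  have "finite \<S>" "C \<in> \<S>" using C edges by (auto simp: \<S>_def edg_def)
  then obtain S where "is_arg_min card (\<lambda>S. S \<in> \<S>) S"
    using ex_is_arg_min_if_finite[of \<S> card] by blast
  then have S: "S \<in> \<S>" and min: "\<And>S'. S' \<in> \<S> \<Longrightarrow> card S \<le> card S'"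
    by (auto simp: is_arg_min_linorder)
  have finS: "finite S" using S C finite_subset by (auto simp: \<S>_def)
  have "t / 2 \<le> real (card {y \<in> S. E x y})" if x: "x \<in> S" for x
  proof (rule ccontr)
    assume *: "\<not> t / 2 \<le> real (card {y \<in> S. E x y})"
    define N where "N = {y \<in> S. E x y}"
    have finN: "finite N" using finS by (simp add: N_def)
    have "edg S \<subseteq> edg (S - {x}) \<union> ({x} \<times> N \<union> N \<times> {x})"
      using sym by (auto simp: edg_def N_def)
    moreover have "edg (S - {x}) \<subseteq> S \<times> S" by (auto simp: edg_def)
    then have "finite (edg (S - {x}))" using finS by (meson finite_SigmaI finite_subset)
    ultimately have "card (edg S) \<le> card (edg (S - {x}) \<union> ({x} \<times> N \<union> N \<times> {x}))"
      using finN by (intro card_mono) auto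
    also have "\<dots> \<le> card (edg (S - {x})) + (card ({x} \<times> N) + card (N \<times> {x}))"
      by (meson add_left_mono card_Un_le order_trans)
    finally have "card (edg S) \<le> card (edg (S - {x})) + 2 * card N"
      by (simp add: card_cartesian_product)
    then have "real (card (edg S)) \<le> real (card (edg (S - {x}))) + 2 * real (card N)"
      by linarith
    moreover have "t * real (card S) \<le> real (card (edg S))" using S by (simp add: \<S>_def)
    moreover have "real (card S) = real (card (S - {x})) + 1"
      using x finS by (simp add: card_Suc_Diff1[symmetric] del: card_Diff_insert)
    ultimately have less: "t * real (card (S - {x})) < real (card (edg (S - {x})))"
      using * by (simp add: N_def algebra_simps)
    have "S - {x} \<noteq> {}"
    proof
      assume "S - {x} = {}"
      then have "edg (S - {x}) = {}" by (auto simp: edg_def)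
      then show False using less t by (simp del: Diff_eq_empty_iff add: \<open>S - {x} = {}\<close>)
    qed
    then have "S - {x} \<in> \<S>" using less S by (auto simp: \<S>_def)
    then show False using min[of "S - {x}"] card_Diff1_less[OF finS x] by linarith
  qed
  with S that show thesis by (auto simp: \<S>_def)
qed

section \<open>A sum-product estimate in prime fields\<close>

text \<open>A copy of a prime field inside a commutative ring; its unit \<open>e\<close> need not be the unit
  of the ring.\<close>

locale prime_subfield =
  fixes F :: "'a::comm_ring_1 set" and e :: 'a
  assumes finite_F: "finite F"
    and zero_F: "0 \<in> F"
    and e_F: "e \<in> F"
    and diff_F: "x \<in> F \<Longrightarrow> y \<in> F \<Longrightarrow> x - y \<in> F"
    and mult_F: "x \<in> F \<Longrightarrow> y \<in> F \<Longrightarrow> x * y \<in> F"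
    and e_mult: "x \<in> F \<Longrightarrow> e * x = x"
    and ex_recip: "x \<in> F \<Longrightarrow> x \<noteq> 0 \<Longrightarrow> \<exists>y\<in>F. x * y = e"
    and generated: "0 \<in> R \<Longrightarrow> (\<And>x. x \<in> R \<Longrightarrow> x - e \<in> R) \<Longrightarrow> F \<subseteq> R"
begin

section \<open>Arithmetic inside the embedded field\<close>

lemma add_F: "x \<in> F \<Longrightarrow> y \<in> F \<Longrightarrow> x + y \<in> F"
  using diff_F[of x "0 - y"] diff_F[of 0 y] zero_F by simp

text \<open>The inverse is taken relative to the unit \<open>e\<close> of \<open>F\<close>; the
  lemmas below control it on \<open>F - {0}\<close> only.\<close>

definition recip :: "'a \<Rightarrow> 'a"
  where "recip x = (SOME y. y \<in> F \<and> x * y = e)"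

lemma recip:
  assumes "x \<in> F - {0}"
  shows "recip x \<in> F - {0}" "x * recip x = e"
proof -
  have "\<exists>y. y \<in> F \<and> x * y = e" using ex_recip assms by blast
  from someI_ex[OF this] have r: "recip x \<in> F" "x * recip x = e" by (auto simp: recip_def)
  moreover have "recip x \<noteq> 0" using r(2) e_mult[of x] assms by auto
  ultimately show "recip x \<in> F - {0}" "x * recip x = e" by auto
qed

text \<open>The ambient ring may have zero divisors, so cancellation goes through the inverse within
  \<open>F\<close>.\<close>

lemma mult_cancel:
  assumes "a \<in> F - {0}" "x \<in> F" "y \<in> F" "a * x = a * y"
  shows "x = y"
proof -
  have "recip a * (a * z) = z" if "z \<in> F" for z
  proof -
    have "recip a * (a * z) = (a * recip a) * z" by (simp add: mult_ac)
    then show ?thesis using recip(2)[OF assms(1)] e_mult[OF that] by simp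
  qed
  then show ?thesis using assms by metis
qed

lemma inj_on_mult: "a \<in> F - {0} \<Longrightarrow> X \<subseteq> F \<Longrightarrow> inj_on ((*) a) X"
  by (rule inj_onI) (meson mult_cancel subsetD)

lemma card_dilate: "a \<in> F - {0} \<Longrightarrow> X \<subseteq> F \<Longrightarrow> card ((*) a ` X) = card X"
  by (simp add: card_image inj_on_mult)

lemma diff_set_dilate: fixes a :: 'a shows "diff_set ((*) a ` X) ((*) a ` Y) = (*) a ` diff_set X Y"
proof (rule Set.set_eqI)
  fix z :: 'a
  have "z \<in> diff_set ((*) a ` X) ((*) a ` Y) \<longleftrightarrow> (\<exists>x\<in>X. \<exists>y\<in>Y. z = a * (x - y))"
    by (simp add: mem_diff_set right_diff_distrib)
  also have "\<dots> \<longleftrightarrow> z \<in> (*) a ` diff_set X Y"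
    unfolding image_iff Bex_def mem_diff_set by blast
  finally show "z \<in> diff_set ((*) a ` X) ((*) a ` Y) \<longleftrightarrow> z \<in> (*) a ` diff_set X Y" .
qed

section \<open>Additive energy of dilates and the sum-product estimate\<close>

text \<open>Average over \<open>r \<in> F\<close>. Equal points collide for every \<open>r\<close>,
  distinct points for at most one, the solution of a linear equation. The hypothesis
  \<open>small\<close> makes the second contribution no larger than the first.\<close>

lemma exists_small_energy:
  assumes C: "C \<subseteq> F" and small: "card C ^ 2 \<le> card F"
  obtains r where "r \<in> F"
    "card {(s, t). s \<in> C \<times> C \<and> t \<in> C \<times> C \<and> fst s + r * snd s = fst t + r * snd t} \<le> 2 * card C ^ 2"
proof -
  define coll where "coll r = {(s, t). s \<in> C \<times> C \<and> t \<in> C \<times> C \<and> fst s + r * snd s = fst t + r * snd t}" for r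
  define Q where "Q = (C \<times> C) \<times> (C \<times> C)"
  have finC: "finite C" using C finite_F finite_subset by blast
  have finQ: "finite Q" using finC by (simp add: Q_def)
  have "(\<Sum>r\<in>F. card (coll r)) = (\<Sum>r\<in>F. \<Sum>z\<in>Q. of_bool (z \<in> coll r))"
  proof (rule sum.cong[OF refl])
    fix r
    have "coll r \<subseteq> Q" by (auto simp: coll_def Q_def)
    then have "coll r = {z \<in> Q. z \<in> coll r}" by blast
    then have "card (coll r) = card {z \<in> Q. z \<in> coll r}" by simp
    then show "card (coll r) = (\<Sum>z\<in>Q. of_bool (z \<in> coll r))"
      using finQ by (simp add: sum.If_cases of_bool_def Int_def)
  qed
  also have "\<dots> = (\<Sum>z\<in>Q. \<Sum>r\<in>F. of_bool (z \<in> coll r))" by (rule sum.swap)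
  also have "\<dots> = (\<Sum>z\<in>Q. card {r \<in> F. z \<in> coll r})"
    using finite_F by (simp add: sum.If_cases of_bool_def Int_def)
  also have "\<dots> \<le> (\<Sum>z\<in>Q. card F * of_bool (fst z = snd z) + 1)"
  proof (rule sum_mono)
    fix z assume z: "z \<in> Q"
    show "card {r \<in> F. z \<in> coll r} \<le> card F * of_bool (fst z = snd z) + 1"
    proof (cases "fst z = snd z")
      case True
      then show ?thesis using finite_F by (auto intro!: le_SucI card_mono)
    next
      case False
      have "r = r'" if "r \<in> F" "r' \<in> F" "z \<in> coll r" "z \<in> coll r'" for r r'
      proof -
        obtain x y x' y' where zz: "z = ((x, y), (x', y'))" by (metis surj_pair)
        have F: "x \<in> F" "y \<in> F" "x' \<in> F" "y' \<in> F" using z C zz by (auto simp: Q_def)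
        have eq: "x + r * y = x' + r * y'" "x + r' * y = x' + r' * y'"
          using that zz by (auto simp: coll_def)
        have "y \<noteq> y'" using False eq zz by auto
        then have "y - y' \<in> F - {0}" using F diff_F by auto
        moreover have "(y - y') * s = x' - x" if "x + s * y = x' + s * y'" for s
        proof -
          have "s * y = x' + s * y' - x" using that by (simp add: eq_diff_eq add.commute)
          then show ?thesis by (simp add: algebra_simps)
        qed
        with eq have "(y - y') * r = (y - y') * r'" by simp
        ultimately show ?thesis using that mult_cancel by blast
      qed
      then have "card {r \<in> F. z \<in> coll r} \<le> Suc 0"
        using finite_F by (simp add: card_le_Suc0_iff_eq)
      then show ?thesis by simp
    qed
  qed
  also have "\<dots> = card F * (\<Sum>z\<in>Q. of_bool (fst z = snd z)) + card Q"
    by (simp only: sum.distrib card_eq_sum flip: sum_distrib_left)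
  also have "(\<Sum>z\<in>Q. of_bool (fst z = snd z)) = card {z \<in> Q. fst z = snd z}"
    using finQ by (simp add: sum.If_cases of_bool_def Int_def)
  also have "card {z \<in> Q. fst z = snd z} = card C ^ 2"
  proof -
    have "{z \<in> Q. fst z = snd z} = (\<lambda>s. (s, s)) ` (C \<times> C)" by (auto simp: Q_def)
    then show ?thesis by (simp add: card_image inj_on_def card_cartesian_product power2_eq_square)
  qed
  also have "card Q = card C ^ 2 * card C ^ 2"
    by (simp add: Q_def card_cartesian_product power2_eq_square)
  also have "card F * card C ^ 2 + card C ^ 2 * card C ^ 2 \<le> card F * (2 * card C ^ 2)"
    using mult_right_mono[OF small, of "card C ^ 2"] by simp
  finally have le: "(\<Sum>r\<in>F. card (coll r)) \<le> card F * (2 * card C ^ 2)" .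
  have "\<exists>r\<in>F. card (coll r) \<le> 2 * card C ^ 2"
  proof (rule ccontr)
    assume "\<not> ?thesis"
    then have "\<And>r. r \<in> F \<Longrightarrow> 2 * card C ^ 2 < card (coll r)" by auto
    then have "(\<Sum>r\<in>F. 2 * card C ^ 2) < (\<Sum>r\<in>F. card (coll r))"
      using finite_F zero_F by (intro sum_strict_mono) auto
    then show False using le by simp
  qed
  then show thesis using that by (auto simp: coll_def)
qed

text \<open>The alternatives are the outcomes of the final case split: the degree bound
  \<open>N\<close> is trivial, the difference quotients of \<open>S\<close> fill \<open>F\<close>,
  or they miss some \<open>r - e\<close>. The constant is \<open>162 * 2^6\<close> in one case and
  \<open>324 * 2^5\<close> in the other, the powers of 2 coming from the halved degree in
  \<open>N\<close>.\<close>

lemma sum_product: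
  assumes C: "C \<subseteq> F - {0}" "C \<noteq> {}" and small: "card C ^ 2 \<le> card F"
  defines "m \<equiv> real (card C)" and "v \<equiv> real (card (C * recip ` C))" and "\<Delta> \<equiv> real (card (diff_set C C))"
  shows "m^2 \<le> 2 * v \<or> m^13 \<le> 10368 * v^6 * \<Delta>^6 \<or> m^13 \<le> 10368 * v^5 * \<Delta>^7"
proof -
  have CF: "C \<subseteq> F" using C by blast
  have finC: "finite C" using CF finite_F finite_subset by blast
  have m: "m > 0" using C finC by (simp add: m_def card_gt_0_iff)
  have fin_ratio: "finite (C * recip ` C)" using finC by (simp add: finite_set_times)
  have "C * recip ` C \<noteq> {}" using C by (auto simp: set_times_def)
  then have v: "v > 0" using fin_ratio by (simp add: v_def card_gt_0_iff)
  have \<Delta>0: "\<Delta> \<ge> 0" by (simp add: \<Delta>_def)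
  define \<Gamma> where "\<Gamma> a = {(c, x). c \<in> C \<and> x \<in> C \<and> c * x \<in> (*) a ` C}" for a
  have fin\<Gamma>: "finite (\<Gamma> a)" for a
    by (rule finite_subset[of _ "C \<times> C"]) (use finC in \<open>auto simp: \<Gamma>_def\<close>)
  \<comment> \<open>Cauchy-Schwarz gives at least \<open>m^4 / v\<close> solutions of
    \<open>c / a = y / x\<close>, that is of \<open>c * x = a * y\<close>. Some \<open>a\<close>
    takes part in at least the average number of them.\<close>
  obtain a0 where a0: "a0 \<in> C" and a0_edges: "m^2 / v * m \<le> real (card (\<Gamma> a0))"
  proof -
    define f where "f = (\<lambda>(c, a). c * recip a)"
    define coll where "coll = {(s, t). s \<in> C \<times> C \<and> t \<in> C \<times> C \<and> f s = f t}"
    have "real (card (C \<times> C)) ^ 2 \<le> real (card (C * recip ` C)) * real (card coll)"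
      unfolding coll_def by (rule card_sq_le_collisions) (use finC fin_ratio in \<open>auto simp: f_def\<close>)
    then have coll_ge: "m^4 \<le> v * real (card coll)"
      by (simp add: m_def v_def card_cartesian_product power2_eq_square power4_eq_xxxx mult_ac)
    have cross: "c * x = a * y" if "c \<in> C" "a \<in> C" "x \<in> C" "y \<in> C" "c * recip a = y * recip x" for c a x y
    proof -
      have "c * x = e * (c * x)" using that CF by (simp add: e_mult mult_F subset_iff)
      also have "\<dots> = (a * recip a) * (c * x)"
        using recip(2)[OF subsetD[OF C(1) that(2)]] by simp
      also have "\<dots> = (c * recip a) * (a * x)" by (simp only: mult_ac)
      also have "\<dots> = (y * recip x) * (a * x)" by (simp only: that(5))
      also have "\<dots> = (x * recip x) * (a * y)" by (simp only: mult_ac)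
      also have "\<dots> = e * (a * y)"
        using recip(2)[OF subsetD[OF C(1) that(3)]] by simp
      also have "\<dots> = a * y" using that CF by (simp add: e_mult mult_F subset_iff)
      finally show ?thesis .
    qed
    \<comment> \<open>The coordinate \<open>y\<close> may be forgotten, because
      \<open>c * x = a * y\<close> recovers it by cancelling \<open>a\<close>.\<close>
    define h :: "('a \<times> 'a) \<times> ('a \<times> 'a) \<Rightarrow> 'a \<times> 'a \<times> 'a"
      where "h = (\<lambda>((c, a), (y, x)). (a, (c, x)))"
    have "card coll \<le> card (SIGMA a:C. \<Gamma> a)"
    proof (rule card_inj_on_le[of h])
      show "inj_on h coll"
      proof (rule inj_onI)
        fix s t
        assume st: "s \<in> coll" "t \<in> coll" "h s = h t"
        obtain c a y x where s: "s = ((c, a), (y, x))" by (metis surj_pair)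
        with st(3) obtain y' where t: "t = ((c, a), (y', x))" by (cases t) (auto simp: h_def)
        have H: "c \<in> C" "a \<in> C" "x \<in> C" "y \<in> C" "y' \<in> C"
          "c * recip a = y * recip x" "c * recip a = y' * recip x"
          using st(1,2) by (auto simp: coll_def f_def s t)
        then have "a * y = a * y'" using cross by metis
        then have "y = y'" using mult_cancel[of a y y'] H C by blast
        then show "s = t" by (simp add: s t)
      qed
      show "h ` coll \<subseteq> (SIGMA a:C. \<Gamma> a)"
      proof
        fix z assume "z \<in> h ` coll"
        then obtain s where s: "s \<in> coll" "z = h s" by blast
        obtain c a y x where s': "s = ((c, a), (y, x))" by (metis surj_pair)
        have H: "c \<in> C" "a \<in> C" "x \<in> C" "y \<in> C" "c * recip a = y * recip x"
          using s(1) by (auto simp: s' coll_def f_def)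
        then show "z \<in> (SIGMA a:C. \<Gamma> a)"
          using cross[OF H] by (simp add: s(2) s' h_def \<Gamma>_def)
      qed
      show "finite (SIGMA a:C. \<Gamma> a)" using finC fin\<Gamma> by blast
    qed
    also have "\<dots> = (\<Sum>a\<in>C. card (\<Gamma> a))" using finC fin\<Gamma> by simp
    finally have coll_le: "real (card coll) \<le> (\<Sum>a\<in>C. real (card (\<Gamma> a)))"
      by (simp flip: of_nat_sum)
    have "\<exists>a\<in>C. m^2 / v * m \<le> real (card (\<Gamma> a))"
    proof (rule ccontr)
      assume "\<not> ?thesis"
      then have "(\<Sum>a\<in>C. real (card (\<Gamma> a))) < (\<Sum>a\<in>C. m^2 / v * m)"
        using finC C by (intro sum_strict_mono) auto
      also have "\<dots> = m * (m^2 / v * m)" by (simp add: m_def)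
      finally have "real (card coll) < m * (m^2 / v * m)" using coll_le by linarith
      then have "v * real (card coll) < v * (m * (m^2 / v * m))"
        using v by (rule mult_strict_left_mono)
      also have "\<dots> = m^4" using v by (simp add: power2_eq_square power4_eq_xxxx)
      finally show False using coll_ge by simp
    qed
    then show thesis using that by blast
  qed
  \<comment> \<open>Half the average degree of the graph on \<open>C\<close> joining
    \<open>c\<close> and \<open>x\<close> when \<open>c * x\<close> lies in the dilate of
    \<open>C\<close> by \<open>a0\<close>; this is the minimum degree kept on
    \<open>S\<close>.\<close>
  define N where "N = m^2 / v / 2"
  have N: "N > 0" using m v by (simp add: N_def)
  define Z where "Z = (*) a0 ` C"
  have a0F: "a0 \<in> F - {0}" using a0 C by blast
  have finZ: "finite Z" using finC by (simp add: Z_def)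
  have cardZ: "real (card Z) = m" using card_dilate[OF a0F CF] by (simp add: Z_def m_def)
  obtain S where S: "S \<subseteq> C" "S \<noteq> {}" and S_deg: "\<And>c. c \<in> S \<Longrightarrow> N \<le> real (card {x \<in> S. x \<in> C \<and> c \<in> C \<and> c * x \<in> Z})"
    unfolding N_def
  proof (rule min_degree_subset[OF finC C(2), of "\<lambda>c x. x \<in> C \<and> c \<in> C \<and> c * x \<in> Z" "m^2 / v"])
    show "m^2 / v * real (card C) \<le> real (card {(c, x). c \<in> C \<and> x \<in> C \<and> x \<in> C \<and> c \<in> C \<and> c * x \<in> Z})"
      using a0_edges by (simp add: \<Gamma>_def Z_def m_def conj_ac cong: conj_cong)
  qed (use m v in \<open>auto simp: mult.commute\<close>)
  \<comment> \<open>On \<open>X c\<close> the dilation by \<open>c\<close> stays inside \<open>Z\<close>, which saves two covering steps in \<open>pivot\<close>.\<close>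
  define X where "X c = {x \<in> S. c * x \<in> Z}" for c
  have XS: "X c \<subseteq> S" for c by (auto simp: X_def)
  have finS: "finite S" using S finC finite_subset by blast
  have finX: "finite (X c)" for c using XS finS finite_subset by blast
  have XF: "X c \<subseteq> F" "X c \<subseteq> C" for c using XS S CF by blast+
  have cardX: "N \<le> real (card (X c))" if "c \<in> S" for c
  proof -
    have "{x \<in> S. x \<in> C \<and> c \<in> C \<and> c * x \<in> Z} = X c" using S that by (auto simp: X_def)
    then show ?thesis using S_deg[OF that] by simp
  qed
  have SF: "c \<in> F - {0}" if "c \<in> S" for c using that S C by blast
  have card_diff_dil: "real (card (diff_set Y ((*) b ` C))) \<le> \<Delta>"
    if "b \<in> F - {0}" "Y \<subseteq> (*) b ` C" for b Y
  proof -
    have "card (diff_set Y ((*) b ` C)) \<le> card (diff_set ((*) b ` C) ((*) b ` C))"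
      using that finC by (intro card_mono diff_set_mono) auto
    also have "\<dots> \<le> card (diff_set C C)"
      unfolding diff_set_dilate using finC by (intro card_image_le) auto
    finally show ?thesis by (simp add: \<Delta>_def)
  qed
  define \<beta> where "\<beta> = \<Delta>^2 / N"
  have \<beta>0: "\<beta> \<ge> 0" using N by (simp add: \<beta>_def)
  \<comment> \<open>The dilates of \<open>C\<close> by \<open>a0\<close> and \<open>b\<close> share
    the set \<open>Y\<close>, which contains the dilate of \<open>X b\<close> and so has at least
    \<open>N\<close> elements. Ruzsa's inequality through \<open>Y\<close> bounds their difference
    set.\<close>
  have dil: "real (card (diff_set Z ((*) b ` C))) \<le> \<beta>" if b: "b \<in> S" for b
  proof -
    define Y where "Y = (*) b ` C \<inter> Z"
    have finY: "finite Y" using finZ by (simp add: Y_def)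
    have "N \<le> real (card (X b))" by (rule cardX[OF b])
    also have "card (X b) = card ((*) b ` X b)" using card_dilate[OF SF[OF b] XF(1)] by simp
    also have "\<dots> \<le> card Y" using finY XF(2) by (intro card_mono) (auto simp: Y_def X_def)
    finally have NY: "N \<le> real (card Y)" by simp
    have "N * real (card (diff_set Z ((*) b ` C))) \<le> real (card Y) * real (card (diff_set Z ((*) b ` C)))"
      using NY by (intro mult_right_mono) auto
    also have "\<dots> \<le> real (card (diff_set Y Z)) * real (card (diff_set Y ((*) b ` C)))"
      using ruzsa_triangle[of Y Z "(*) b ` C"] finY finZ finC
      by (simp flip: of_nat_mult)
    also have "\<dots> \<le> \<Delta> * \<Delta>"
      using card_diff_dil[OF a0F, of Y] card_diff_dil[OF SF[OF b], of Y]
      by (intro mult_mono) (auto simp: Y_def Z_def \<Delta>0)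
    finally show ?thesis using N by (simp add: \<beta>_def field_simps power2_eq_square)
  qed
  \<comment> \<open>One subset \<open>T\<close> of \<open>Z\<close> works for all three summands.
    Ruzsa's inequality through \<open>T\<close> joins the bounds for \<open>T + W + W\<close> and
    \<open>T + B + D\<close>; each carries a factor 9, since the factor
    \<open>card {B, D, W} \<le> 3\<close> enters twice.\<close>
  have four: "real (card (diff_set (Z + Z) ((*) b ` C + (*) d ` C))) * m^3 \<le> 81 * \<beta>^2 * \<Delta>^2"
    if b: "b \<in> S" and d: "d \<in> S" for b d
  proof -
    define B where "B = uminus ` (*) b ` C"
    define D where "D = uminus ` (*) d ` C"
    define W where "W = uminus ` Z"
    have fin: "finite B" "finite D" "finite W" using finC finZ by (auto simp: B_def D_def W_def)
    have "Z \<noteq> {}" using C by (simp add: Z_def)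
    then obtain T where T: "T \<subseteq> Z" "T \<noteq> {}" and pl: "\<And>Y E. Y \<in> {B, D, W} \<Longrightarrow> finite E \<Longrightarrow>
        card Z * card (T + Y + E) \<le> card {B, D, W} * card (Z + Y) * card (T + E)"
      using plunnecke_petridis[OF finZ, of "{B, D, W}"] fin by blast
    have finT: "finite T" using T finZ finite_subset by blast
    have cT: "real (card T) > 0" using T finT by (simp add: card_gt_0_iff)
    have cTm: "real (card T) \<le> m" using card_mono[OF finZ T(1)] cardZ by linarith
    have pl': "m * real (card (T + Y + E)) \<le> 3 * k * real (card (T + E))"
      if "Y \<in> {B, D, W}" "finite E" "real (card (Z + Y)) \<le> k" for Y E k
    proof -
      have "m * real (card (T + Y + E)) = real (card Z * card (T + Y + E))" by (simp add: cardZ)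
      also have "\<dots> \<le> real (card {B, D, W} * card (Z + Y) * card (T + E))"
        using pl[OF that(1,2)] by (simp only: of_nat_le_iff)
      also have "\<dots> = real (card {B, D, W}) * real (card (Z + Y)) * real (card (T + E))" by simp
      also have "\<dots> \<le> 3 * k * real (card (T + E))"
        using that(3) by (intro mult_right_mono mult_mono) (auto simp: card_insert_if)
      finally show ?thesis .
    qed
    have two: "m^2 * real (card (T + Y + Y')) \<le> 9 * k^2 * real (card T)"
      if "Y \<in> {B, D, W}" "Y' \<in> {B, D, W}" "real (card (Z + Y)) \<le> k" "real (card (Z + Y')) \<le> k" for Y Y' k
    proof -
      have k: "k \<ge> 0" using that(3) by linarith
      have finY': "finite Y'" using that fin by blast
      have "m^2 * real (card (T + Y + Y')) = m * (m * real (card (T + Y + Y')))" by (simp add: power2_eq_square)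
      also have "\<dots> \<le> m * (3 * k * real (card (T + Y')))"
        using pl'[OF that(1) finY' that(3)] m by (intro mult_left_mono) auto
      \<comment> \<open>Adding \<open>{0}\<close> brings \<open>T + Y'\<close> into the shape to
        which the Pluennecke bound applies a second time.\<close>
      also have "\<dots> = 3 * k * (m * real (card (T + Y' + {0})))" by (simp add: set_plus_def)
      also have "\<dots> \<le> 3 * k * (3 * k * real (card (T + {0})))"
        using pl'[OF that(2) _ that(4), of "{0}"] k by (intro mult_left_mono) auto
      also have "\<dots> = 9 * k^2 * real (card T)" by (simp add: power2_eq_square set_plus_def)
      finally show ?thesis .
    qed
    have neg_plus: "uminus ` (P + Q) = uminus ` P + uminus ` Q" for P Q :: "'a set"
      by (force simp: set_plus_def image_iff)
    have D1: "diff_set T ((*) b ` C + (*) d ` C) = T + B + D"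
      by (simp add: diff_set_def neg_plus B_def D_def add.assoc)
    have D2: "diff_set T (Z + Z) = T + W + W"
      by (simp add: diff_set_def neg_plus W_def add.assoc)
    have TBD: "m^2 * real (card (T + B + D)) \<le> 9 * \<beta>^2 * real (card T)"
      using dil[OF b] dil[OF d] by (intro two) (auto simp: diff_set_def B_def D_def)
    have TWW: "m^2 * real (card (T + W + W)) \<le> 9 * \<Delta>^2 * real (card T)"
      using card_diff_dil[OF a0F, of Z] by (intro two) (auto simp: diff_set_def W_def Z_def)
    have prod: "(m^2 * real (card (T + W + W))) * (m^2 * real (card (T + B + D)))
        \<le> (9 * \<Delta>^2 * real (card T)) * (9 * \<beta>^2 * real (card T))"
      by (rule mult_mono[OF TWW TBD]) auto
    define M where "M = real (card (diff_set (Z + Z) ((*) b ` C + (*) d ` C)))"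
    have "real (card T) * M \<le> real (card (T + W + W)) * real (card (T + B + D))"
      using ruzsa_triangle[of T "Z + Z" "(*) b ` C + (*) d ` C"] finT finZ finC
      by (simp add: D1 D2 M_def finite_set_plus flip: of_nat_mult)
    then have "(real (card T) * M) * m^4 \<le> (real (card (T + W + W)) * real (card (T + B + D))) * m^4"
      using m by (intro mult_right_mono) auto
    also have "\<dots> \<le> (9 * \<Delta>^2 * real (card T)) * (9 * \<beta>^2 * real (card T))"
      using prod by (simp add: power2_eq_square power4_eq_xxxx mult_ac)
    finally have "real (card T) * (M * m^4) \<le> real (card T) * (81 * \<beta>^2 * \<Delta>^2 * real (card T))"
      by (simp add: mult_ac)
    then have "M * m^4 \<le> 81 * \<beta>^2 * \<Delta>^2 * real (card T)" using cT by simp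
    also have "\<dots> \<le> 81 * \<beta>^2 * \<Delta>^2 * m" using cTm by (intro mult_left_mono) auto
    finally have "m * (M * m^3) \<le> m * (81 * \<beta>^2 * \<Delta>^2)" by (simp add: power_def numeral_eq_Suc mult_ac)
    then show ?thesis using m by (simp add: M_def)
  qed
  \<comment> \<open>Multiplying by \<open>c - d\<close> clears the denominator:
    \<open>(c - d) * (x + r * y) = (c * x + a * y) - (b * y + d * x)\<close>, where
    \<open>c * x\<close> and \<open>a * y\<close> lie in \<open>Z\<close>.\<close>
  have pivot: "real (card (X c + (*) r ` X a)) * m^3 * N^2 \<le> 81 * \<Delta>^6"
    if abcd: "a \<in> S" "b \<in> S" "c \<in> S" "d \<in> S" "c \<noteq> d" and r: "r \<in> F" "r * (c - d) = a - b" for a b c d r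
  proof -
    have cd: "c - d \<in> F - {0}" using abcd SF diff_F by auto
    have sub: "X c + (*) r ` X a \<subseteq> F"
      using XF(1) r by (auto simp: set_plus_def subset_iff intro!: add_F mult_F)
    have "(*) (c - d) ` (X c + (*) r ` X a) \<subseteq> diff_set (Z + Z) ((*) b ` C + (*) d ` C)"
    proof
      fix z assume "z \<in> (*) (c - d) ` (X c + (*) r ` X a)"
      then obtain x y where xy: "x \<in> X c" "y \<in> X a" "z = (c - d) * (x + r * y)"
        by (auto simp: set_plus_def)
      have "z = (c - d) * x + (r * (c - d)) * y" using xy(3) by (simp add: algebra_simps)
      also have "\<dots> = (c - d) * x + (a - b) * y" by (simp only: r(2))
      also have "\<dots> = (c * x + a * y) - (b * y + d * x)" by (simp add: algebra_simps)
      finally have z: "z = (c * x + a * y) - (b * y + d * x)" .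
      have "x \<in> C" "y \<in> C" using xy XF(2) by blast+
      moreover have "c * x \<in> Z" "a * y \<in> Z" using xy by (auto simp: X_def)
      ultimately show "z \<in> diff_set (Z + Z) ((*) b ` C + (*) d ` C)"
        unfolding z by (intro diff_setI set_plus_intro imageI)
    qed
    moreover have "finite (diff_set (Z + Z) ((*) b ` C + (*) d ` C))"
      using finZ finC by (intro finite_diff_set finite_set_plus) auto
    ultimately have "card (X c + (*) r ` X a) \<le> card (diff_set (Z + Z) ((*) b ` C + (*) d ` C))"
      using card_dilate[OF cd sub] by (metis card_mono)
    then have "real (card (X c + (*) r ` X a)) * m^3 \<le> real (card (diff_set (Z + Z) ((*) b ` C + (*) d ` C))) * m^3"
      using m by (intro mult_right_mono) auto
    also have "\<dots> \<le> 81 * \<beta>^2 * \<Delta>^2" by (rule four[OF abcd(2,4)])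
    finally have "real (card (X c + (*) r ` X a)) * m^3 * N^2 \<le> 81 * \<beta>^2 * \<Delta>^2 * N^2"
      by (intro mult_right_mono) auto
    also have "\<dots> = 81 * \<Delta>^6" using N by (simp add: \<beta>_def power_divide flip: power_mult power_add)
    finally show ?thesis .
  qed
  \<comment> \<open>The difference quotients \<open>(a - b) / (c - d)\<close> of \<open>S\<close>,
    written without division.\<close>
  define R where "R = {r \<in> F. \<exists>a\<in>S. \<exists>b\<in>S. \<exists>c\<in>S. \<exists>d\<in>S. c \<noteq> d \<and> r * (c - d) = a - b}"
  consider "N \<le> 1" | "N > 1" "F \<subseteq> R" | "N > 1" "\<not> F \<subseteq> R" by linarith
  then show ?thesis
  proof cases
    case 1
    then have "m^2 \<le> 2 * v" using v by (simp add: N_def field_simps)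
    then show ?thesis by blast
  next
    case 2
    \<comment> \<open>Every \<open>r \<in> F\<close> is now a difference quotient, so one of small
      energy may be chosen. Cauchy-Schwarz then forces the sumset of \<open>X c\<close> and the
      dilate of \<open>X a\<close> to have at least \<open>N^4 / (2 * m^2)\<close> elements, against
      the upper bound from \<open>pivot\<close>.\<close>
    obtain r where r: "r \<in> F" and energy:
      "card {(s, t). s \<in> C \<times> C \<and> t \<in> C \<times> C \<and> fst s + r * snd s = fst t + r * snd t} \<le> 2 * card C ^ 2"
      using exists_small_energy[OF CF small] .
    obtain a b c d where abcd: "a \<in> S" "b \<in> S" "c \<in> S" "d \<in> S" "c \<noteq> d" "r * (c - d) = a - b"
      using 2 r by (auto simp: R_def)
    define M where "M = real (card (X c + (*) r ` X a))"
    have M0: "M \<ge> 0" by (simp add: M_def)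
    have "real (card (X c \<times> X a)) ^ 2 \<le> M * real (card {(s, t). s \<in> X c \<times> X a \<and> t \<in> X c \<times> X a \<and>
        (\<lambda>s. fst s + r * snd s) s = (\<lambda>s. fst s + r * snd s) t})"
      unfolding M_def by (rule card_sq_le_collisions) (use finX in \<open>auto simp: finite_set_plus\<close>)
    also have "\<dots> \<le> M * real (card {(s, t). s \<in> C \<times> C \<and> t \<in> C \<times> C \<and> fst s + r * snd s = fst t + r * snd t})"
    proof (intro mult_left_mono of_nat_mono card_mono)
      show "finite {(s, t). s \<in> C \<times> C \<and> t \<in> C \<times> C \<and> fst s + r * snd s = fst t + r * snd t}"
        by (rule finite_subset[of _ "(C \<times> C) \<times> (C \<times> C)"]) (use finC in auto)
    qed (use XF(2) M0 in auto)
    also have "\<dots> \<le> M * real (2 * card C ^ 2)"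
      using energy M0 by (intro mult_left_mono) (simp_all only: of_nat_le_iff)
    finally have "(real (card (X c)) * real (card (X a)))^2 \<le> 2 * m^2 * M"
      by (simp add: m_def card_cartesian_product mult_ac)
    moreover have "(N * N)^2 \<le> (real (card (X c)) * real (card (X a)))^2"
      using cardX abcd N by (intro power_mono mult_mono) auto
    ultimately have "N^4 \<le> 2 * m^2 * M"
      by (simp add: power2_eq_square power4_eq_xxxx mult_ac)
    then have "N^4 * (m^3 * N^2) \<le> 2 * m^2 * M * (m^3 * N^2)"
      using m by (intro mult_right_mono) auto
    also have "\<dots> = 2 * m^2 * (M * m^3 * N^2)" by (simp add: mult_ac)
    also have "\<dots> \<le> 2 * m^2 * (81 * \<Delta>^6)"
      using pivot[OF abcd(1-5) r abcd(6)] m by (intro mult_left_mono) (auto simp: M_def)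
    finally have "m^2 * (N^6 * m) \<le> m^2 * (162 * \<Delta>^6)" by (simp add: power_def numeral_eq_Suc mult_ac)
    then have "N^6 * m \<le> 162 * \<Delta>^6" using m by simp
    then have "m^13 \<le> 10368 * v^6 * \<Delta>^6"
      using v by (simp add: N_def power_divide field_simps flip: power_mult) (simp add: power_def numeral_eq_Suc mult_ac)
    then show ?thesis by blast
  next
    case 3
    \<comment> \<open>As \<open>N > 1\<close>, \<open>S\<close> has two distinct elements, so
      \<open>0 \<in> R\<close>. Since \<open>R\<close> does not contain \<open>F\<close>,
      \<open>generated\<close> shows that some step from \<open>r\<close> to \<open>r - e\<close>
      leaves \<open>R\<close>.\<close>
    obtain c0 where c0: "c0 \<in> S" using S by blast
    then have "card (X c0) > 1" using cardX[OF c0] 3 by linarith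
    then have "\<not> X c0 \<subseteq> {c0}" using card_mono[of "{c0}" "X c0"] by auto
    then obtain d0 where d0: "d0 \<in> S" "d0 \<noteq> c0" using XS by blast
    have "0 \<in> R" using c0 d0 zero_F by (force simp: R_def)
    then obtain r where r: "r \<in> R" "r - e \<notin> R" using generated[of R] 3 by blast
    then have rF: "r \<in> F" by (simp add: R_def)
    obtain a b c d where abcd: "a \<in> S" "b \<in> S" "c \<in> S" "d \<in> S" "c \<noteq> d" "r * (c - d) = a - b"
      using r by (auto simp: R_def)
    define M where "M = real (card (X c + (*) r ` X a))"
    have M0: "M \<ge> 0" by (simp add: M_def)
    have "X c \<noteq> {}" using cardX[OF abcd(3)] N by auto
    \<comment> \<open>One \<open>T\<close> serves both summands: up to factors 2, removing the
      negated \<open>X a\<close> costs \<open>\<Delta> / x\<close>, and removing the dilate of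
      \<open>X a\<close> costs \<open>M / x\<close>.\<close>
    then obtain T where T: "T \<subseteq> X c" "T \<noteq> {}" and pl: "\<And>Y E. Y \<in> {uminus ` X a, (*) r ` X a} \<Longrightarrow> finite E \<Longrightarrow>
        card (X c) * card (T + Y + E) \<le> card {uminus ` X a, (*) r ` X a} * card (X c + Y) * card (T + E)"
      using plunnecke_petridis[OF finX, of c "{uminus ` X a, (*) r ` X a}"] finX by blast
    have finT: "finite T" using T finX finite_subset by blast
    have cT: "real (card T) > 0" using T finT by (simp add: card_gt_0_iff)
    have le2: "card {uminus ` X a, (*) r ` X a} \<le> 2" by (simp add: card_insert_if)
    define x where "x = real (card (X c))"
    have x: "x \<ge> N" using cardX[OF abcd(3)] by (simp add: x_def)
    have "card (X c + uminus ` X a) \<le> card (diff_set C C)"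
      unfolding diff_set_def[symmetric] using XF(2) finC by (intro card_mono diff_set_mono) auto
    then have cXX: "real (card (X c + uminus ` X a)) \<le> \<Delta>" by (simp add: \<Delta>_def)
    have "x * real (card (T + uminus ` X a + (*) r ` X a))
        \<le> real (card {uminus ` X a, (*) r ` X a}) * real (card (X c + uminus ` X a)) * real (card (T + (*) r ` X a))"
      using pl[of "uminus ` X a" "(*) r ` X a"] finX by (simp add: x_def flip: of_nat_mult)
    also have "\<dots> \<le> 2 * \<Delta> * real (card (T + (*) r ` X a))"
      using le2 cXX by (intro mult_right_mono mult_mono) auto
    finally have s1: "x * real (card (T + uminus ` X a + (*) r ` X a)) \<le> 2 * \<Delta> * real (card (T + (*) r ` X a))" .
    have "x * real (card (T + (*) r ` X a + {0}))
        \<le> real (card {uminus ` X a, (*) r ` X a}) * M * real (card (T + {0}))"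
      using pl[of "(*) r ` X a" "{0}"] finX by (simp add: x_def M_def flip: of_nat_mult)
    also have "\<dots> \<le> 2 * M * real (card (T + {0}))"
      using le2 M0 by (intro mult_right_mono) auto
    finally have s2: "x * real (card (T + (*) r ` X a)) \<le> 2 * M * real (card T)"
      by (simp add: set_plus_def)
    \<comment> \<open>Two pairs with the same value of \<open>s + (r - e) * y\<close> and different
      \<open>y\<close> would exhibit \<open>r - e\<close> as an element of \<open>R\<close>.\<close>
    have "card (T \<times> X a) \<le> card (T + uminus ` X a + (*) r ` X a)"
    proof (rule card_inj_on_le[where f = "\<lambda>(s, y). s + (r - e) * y"])
      show "inj_on (\<lambda>(s, y). s + (r - e) * y) (T \<times> X a)"
      proof (rule inj_onI, clarify)
        fix s y s' y'
        assume H: "s \<in> T" "y \<in> X a" "s' \<in> T" "y' \<in> X a" "s + (r - e) * y = s' + (r - e) * y'"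
        then have inS: "s \<in> S" "s' \<in> S" "y \<in> S" "y' \<in> S" using T XS by blast+
        have "(r - e) * y = s' + (r - e) * y' - s" using H(5) by (simp add: eq_diff_eq add.commute)
        then have "(r - e) * (y - y') = s' - s" by (simp add: right_diff_distrib)
        then have "y = y'" using r(2) inS rF e_F diff_F by (auto simp: R_def)
        then show "s = s' \<and> y = y'" using H(5) by simp
      qed
      show "(\<lambda>(s, y). s + (r - e) * y) ` (T \<times> X a) \<subseteq> T + uminus ` X a + (*) r ` X a"
      proof clarify
        fix s y assume "s \<in> T" "y \<in> X a"
        moreover from this have "s + (r - e) * y = s + - y + r * y"
          using e_mult[OF subsetD[OF XF(1)], of y a] by (simp add: algebra_simps)
        ultimately show "s + (r - e) * y \<in> T + uminus ` X a + (*) r ` X a"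
          by (simp only:) (intro set_plus_intro imageI)
      qed
      show "finite (T + uminus ` X a + (*) r ` X a)" using finT finX by (simp add: finite_set_plus)
    qed
    then have s3: "real (card T) * real (card (X a)) \<le> real (card (T + uminus ` X a + (*) r ` X a))"
      by (simp add: card_cartesian_product flip: of_nat_mult)
    have x0: "x \<ge> 0" by (simp add: x_def)
    have "x^2 * (real (card T) * real (card (X a))) \<le> x * (x * real (card (T + uminus ` X a + (*) r ` X a)))"
      using s3 x0 by (simp add: power2_eq_square mult.assoc mult_left_mono)
    also have "\<dots> \<le> x * (2 * \<Delta> * real (card (T + (*) r ` X a)))"
      using s1 x0 by (intro mult_left_mono)
    also have "\<dots> = 2 * \<Delta> * (x * real (card (T + (*) r ` X a)))" by simp
    also have "\<dots> \<le> 2 * \<Delta> * (2 * M * real (card T))"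
      using s2 \<Delta>0 by (intro mult_left_mono) auto
    finally have "real (card T) * (x^2 * real (card (X a))) \<le> real (card T) * (4 * \<Delta> * M)"
      by (simp add: mult_ac)
    then have "x^2 * real (card (X a)) \<le> 4 * \<Delta> * M" using cT by simp
    moreover have "N^2 * N \<le> x^2 * real (card (X a))"
      using x cardX[OF abcd(1)] N by (intro mult_mono power_mono) auto
    ultimately have "N^3 \<le> 4 * \<Delta> * M" by (simp add: power3_eq_cube power2_eq_square)
    then have "N^3 * (m^3 * N^2) \<le> 4 * \<Delta> * M * (m^3 * N^2)"
      using m by (intro mult_right_mono) auto
    also have "\<dots> = 4 * \<Delta> * (M * m^3 * N^2)" by (simp add: mult_ac)
    also have "\<dots> \<le> 4 * \<Delta> * (81 * \<Delta>^6)"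
      using pivot[OF abcd(1-5) rF abcd(6)] \<Delta>0 by (intro mult_left_mono) (auto simp: M_def)
    finally have "N^5 * m^3 \<le> 324 * \<Delta>^7" by (simp add: power_def numeral_eq_Suc mult_ac)
    then have "m^13 \<le> 10368 * v^5 * \<Delta>^7"
      using v by (simp add: N_def power_divide field_simps flip: power_mult)
    then show ?thesis by blast
  qed
qed

section \<open>Growth of the shifted ratio set\<close>

text \<open>The condition \<open>- e \<notin> A\<close> keeps \<open>A + e\<close> away from 0, so
  that its elements can be cancelled. Up to constants, the alternatives of
  \<open>sum_product\<close> yield \<open>n^5 \<le> u^4\<close>, \<open>n^92 \<le> u^91\<close> and
  \<open>n^101 \<le> u^100\<close>; the first two are weakened to the third by
  \<open>n \<le> u\<close>.\<close>

lemma shifted_ratio_growth: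
  assumes A: "A \<subseteq> F - {0}" "- e \<notin> A" and small: "card A ^ 2 \<le> card F"
  shows "real (card A) ^ 101 \<le> 10^40 * real (card ((\<lambda>a. a + e) ` A * recip ` A)) ^ 100"
proof (cases "A = {}")
  case False
  define B where "B = (\<lambda>a. a + e) ` A"
  define D where "D = recip ` A"
  define U where "U = B * D"
  define V where "V = A * D"
  have AF: "A \<subseteq> F" using A by blast
  have finA: "finite A" using AF finite_F finite_subset by blast
  have D: "D \<subseteq> F - {0}" using A recip(1) by (auto simp: D_def)
  have B: "B \<subseteq> F - {0}"
  proof -
    have "a + e \<noteq> 0" if "a \<in> A" for a
      using A(2) that by (metis add_eq_0_iff2)
    then show ?thesis using AF e_F add_F by (auto simp: B_def)
  qed
  have fin: "finite B" "finite D" "finite U" "finite V"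
    using finA by (auto simp: B_def D_def U_def V_def finite_set_times)
  have recip_recip: "recip (recip a) = a" if "a \<in> F - {0}" for a
  proof (rule mult_cancel[OF recip(1)[OF that]])
    show "recip a * recip (recip a) = recip a * a"
      using recip(2)[OF recip(1)[OF that]] recip(2)[OF that] by (simp add: mult.commute)
  qed (use recip(1)[OF recip(1)[OF that]] that in auto)
  have "inj_on recip A" by (rule inj_on_inverseI[of _ recip]) (use recip_recip A in auto)
  then have cardD: "card D = card A" by (simp add: D_def card_image)
  have cardB: "card B = card A" by (simp add: B_def card_image)
  define n u v where "n = real (card A)" and "u = real (card U)" and "v = real (card V)"
  have n: "n > 0" using False finA by (simp add: n_def card_gt_0_iff)
  \<comment> \<open>Ruzsa's inequality in multiplicative form: for \<open>w = a * x\<close> with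
    \<open>a \<in> A\<close> and \<open>x \<in> D\<close>, the pair \<open>(b / a, b * x)\<close> in
    \<open>U \<times> U\<close> determines \<open>w\<close> as a quotient, and then
    \<open>b\<close>.\<close>
  have "card V * card B \<le> card U * card U"
  proof -
    have "\<forall>w\<in>V. \<exists>q. fst q \<in> A \<and> snd q \<in> D \<and> w = fst q * snd q"
      by (auto simp: V_def elim!: set_times_elim)
    from bchoice[OF this] obtain q where q: "\<And>w. w \<in> V \<Longrightarrow> fst (q w) \<in> A \<and> snd (q w) \<in> D \<and> w = fst (q w) * snd (q w)"
      by blast
    define g where "g = (\<lambda>(w, b). (b * recip (fst (q w)), b * snd (q w)))"
    have "card (V \<times> B) \<le> card (U \<times> U)"
    proof (rule card_inj_on_le[of g])
      show "g ` (V \<times> B) \<subseteq> U \<times> U" using q by (auto simp: g_def U_def D_def)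
      show "finite (U \<times> U)" using fin by simp
      show "inj_on g (V \<times> B)"
      proof (rule inj_onI, clarify)
        fix w b w' b'
        assume H: "w \<in> V" "b \<in> B" "w' \<in> V" "b' \<in> B" "g (w, b) = g (w', b')"
        have key: "(b * recip (fst (q w))) * w = b * snd (q w)" if "w \<in> V" "b \<in> B" for w b
        proof -
          have "(b * recip (fst (q w))) * w = (fst (q w) * recip (fst (q w))) * (b * snd (q w))"
            using q[OF that(1)] by (metis mult.assoc mult.commute)
          also have "\<dots> = e * (b * snd (q w))"
            using recip(2)[OF subsetD[OF A(1)]] q[OF that(1)] by simp
          also have "\<dots> = b * snd (q w)"
            using q[OF that(1)] that B D by (intro e_mult mult_F) auto
          finally show ?thesis .
        qed
        have VF: "V \<subseteq> F" using AF D by (auto simp: V_def elim!: set_times_elim intro!: mult_F)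
        have nz: "b * recip (fst (q w)) \<in> F - {0}"
        proof -
          have r: "recip (fst (q w)) \<in> F - {0}" using q[OF H(1)] A recip(1) by blast
          have "b * recip (fst (q w)) \<noteq> 0"
            using mult_cancel[of b "recip (fst (q w))" 0] r H(2) B zero_F by auto
          then show ?thesis using r H(2) B by (auto intro: mult_F)
        qed
        have eq: "b * recip (fst (q w)) = b' * recip (fst (q w'))" "b * snd (q w) = b' * snd (q w')"
          using H(5) by (auto simp: g_def)
        have "(b * recip (fst (q w))) * w = (b * recip (fst (q w))) * w'"
          using key[OF H(1,2)] key[OF H(3,4)] eq by simp
        then have ww: "w = w'" using mult_cancel[OF nz] H VF by blast
        have "snd (q w) * b = snd (q w) * b'" using eq(2) ww by (simp add: mult.commute)
        then have "b = b'" using mult_cancel[of "snd (q w)" b b'] q[OF H(1)] D B H by blast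
        then show "w = w' \<and> b = b'" using ww by simp
      qed
    qed
    then show ?thesis by (simp add: card_cartesian_product)
  qed
  then have vn: "v * n \<le> u^2" by (simp add: v_def n_def u_def cardB power2_eq_square flip: of_nat_mult)
  \<comment> \<open>The neighbourhood of \<open>x\<close> is the dilate of \<open>B\<close> by
    \<open>x\<close>: its element \<open>x * (a + e)\<close> differs from \<open>x\<close> by
    \<open>a * x \<in> V\<close>.\<close>
  obtain C where C: "C \<subseteq> D" and mC: "card D ^ 2 \<le> 4 * card U * card C"
    and dC: "card (diff_set C C) * card D ^ 6 \<le> 1024 * card U ^ 3 * card V ^ 4"
  proof (rule balog_szemeredi_gowers_pivot[of D U V "\<lambda>x. (*) x ` B"])
    fix x assume x: "x \<in> D"
    then show "(*) x ` B \<subseteq> U" by (auto simp: U_def mult.commute[of x])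
    show "card ((*) x ` B) = card D" using card_dilate[of x B] x D B cardB cardD by auto
    fix w assume "w \<in> (*) x ` B"
    then obtain a where a: "a \<in> A" "w = x * (a + e)" by (auto simp: B_def)
    then have "w - x = a * x" using e_mult[of x] x D by (auto simp: algebra_simps)
    then show "w - x \<in> V" using a x by (simp add: V_def set_times_intro)
  qed (use fin False in \<open>auto simp: D_def\<close>)
  define m \<Delta> k where "m = real (card C)" and "\<Delta> = real (card (diff_set C C))"
    and "k = real (card (C * recip ` C))"
  have "real (card D ^ 2) \<le> real (4 * card U * card C)" using mC by (simp only: of_nat_le_iff)
  then have m1: "n^2 \<le> 4 * u * m" by (simp add: n_def u_def m_def cardD)
  have "real (card (diff_set C C) * card D ^ 6) \<le> real (1024 * card U ^ 3 * card V ^ 4)"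
    using dC by (simp only: of_nat_le_iff)
  then have d1: "\<Delta> * n^6 \<le> 1024 * u^3 * v^4" by (simp add: n_def u_def v_def \<Delta>_def cardD)
  \<comment> \<open>Inverses of elements of \<open>C \<subseteq> D\<close> lie in \<open>A\<close>,
    so the bound on \<open>V\<close> also controls the ratio set of \<open>C\<close>.\<close>
  have "C * recip ` C \<subseteq> V"
  proof -
    have "recip c \<in> A" if "c \<in> C" for c
      using that C recip_recip A by (force simp: D_def)
    then have "recip ` C * C \<subseteq> V" using C unfolding V_def by (intro set_times_mono2) auto
    then show ?thesis by (simp only: mult.commute)
  qed
  then have kv: "k \<le> v" using fin by (simp add: k_def v_def card_mono)
  have "m > 0"
  proof -
    have "4 * u * m > 0" using m1 n by (smt (verit) zero_less_power)
    then show ?thesis by (simp add: m_def zero_less_mult_iff u_def)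
  qed
  then have "C \<noteq> {}" by (auto simp: m_def)
  have "card C \<le> card A" using card_mono[OF fin(2) C] cardD by simp
  then have "card C ^ 2 \<le> card F" using small by (meson order_trans power_mono zero_le)
  then have cases: "m^2 \<le> 2 * k \<or> m^13 \<le> 10368 * k^6 * \<Delta>^6 \<or> m^13 \<le> 10368 * k^5 * \<Delta>^7"
    unfolding m_def k_def \<Delta>_def using C D \<open>C \<noteq> {}\<close> by (intro sum_product) auto
  have "B \<noteq> {}" "D \<noteq> {}" using False by (auto simp: B_def D_def)
  then obtain b where b: "b \<in> B" by blast
  have "card ((*) b ` D) \<le> card U" using fin b by (intro card_mono) (auto simp: U_def)
  moreover have "card ((*) b ` D) = card D" using subsetD[OF B b] D by (intro card_dilate) auto
  ultimately have un: "n \<le> u" by (simp add: n_def u_def cardD)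
  have u: "u > 0" using un n by linarith
  have v0: "v \<ge> 0" "k \<ge> 0" "\<Delta> \<ge> 0" by (simp_all add: v_def k_def \<Delta>_def)
  have "n^101 \<le> 10^40 * u^100"
    using cases
  proof (elim disjE)
    assume "m^2 \<le> 2 * k"
    then have "m^2 * n \<le> 2 * v * n" using kv n by (intro mult_right_mono) auto
    also have "\<dots> \<le> 2 * u^2" using vn by simp
    finally have mn: "m^2 * n \<le> 2 * u^2" .
    have "(n^2)^2 \<le> (4 * u * m)^2" using m1 by (intro power_mono) auto
    then have "(n^2)^2 * n \<le> (4 * u * m)^2 * n" using n by (intro mult_right_mono) auto
    also have "\<dots> = 16 * u^2 * (m^2 * n)" by (simp add: power_mult_distrib mult_ac)
    also have "\<dots> \<le> 16 * u^2 * (2 * u^2)" using mn by (intro mult_left_mono) auto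
    finally have "n^5 \<le> 32 * u^4" by (simp add: power_def numeral_eq_Suc mult_ac)
    then have "n^5 * n^96 \<le> 32 * u^4 * u^96"
      using un n u by (intro mult_mono power_mono) auto
    then have "n^101 \<le> 32 * u^100" by (simp add: mult.assoc flip: power_add)
    also have "\<dots> \<le> 10^40 * u^100" using u by (intro mult_right_mono) auto
    finally show ?thesis .
  next
    assume "m^13 \<le> 10368 * k^6 * \<Delta>^6"
    also have "\<dots> \<le> 10368 * v^6 * \<Delta>^6" using kv v0 by (intro mult_right_mono mult_left_mono power_mono) auto
    finally have mm: "m^13 \<le> 10368 * v^6 * \<Delta>^6" .
    have "(n^2)^13 \<le> (4 * u * m)^13" using m1 by (intro power_mono) auto
    also have "\<dots> = 4^13 * u^13 * m^13" by (simp add: power_mult_distrib)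
    also have "\<dots> \<le> 4^13 * u^13 * (10368 * v^6 * \<Delta>^6)" using mm u by (intro mult_left_mono) auto
    \<comment> \<open>The extra powers of \<open>n\<close> complete \<open>\<Delta>^6\<close> to
      \<open>(\<Delta> * n^6)^6\<close> and the resulting \<open>v^30\<close> to
      \<open>(v * n)^30\<close>, where \<open>d1\<close> and \<open>vn\<close> apply.\<close>
    finally have "(n^2)^13 * (n^6)^6 * n^30 \<le> 4^13 * u^13 * (10368 * v^6 * \<Delta>^6) * (n^6)^6 * n^30"
      using n by (intro mult_right_mono) auto
    also have "\<dots> = 4^13 * 10368 * u^13 * v^6 * (\<Delta> * n^6)^6 * n^30" by (simp add: power_mult_distrib mult_ac)
    also have "\<dots> \<le> 4^13 * 10368 * u^13 * v^6 * (1024 * u^3 * v^4)^6 * n^30"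
      using d1 v0 u n by (intro mult_right_mono mult_left_mono power_mono) auto
    also have "\<dots> = 4^13 * 10368 * 1024^6 * u^31 * (v * n)^30"
    proof -
      have "(1024 * u^3 * v^4)^6 = 1024^6 * u^18 * v^24"
        by (simp only: power_mult_distrib flip: power_mult) simp
      moreover have "u^31 = u^13 * u^18" "v^30 = v^6 * v^24" by (simp_all flip: power_add)
      ultimately show ?thesis by (simp only: power_mult_distrib mult_ac)
    qed
    also have "\<dots> \<le> 4^13 * 10368 * 1024^6 * u^31 * (u^2)^30"
      using vn v0 n u by (intro mult_left_mono power_mono) auto
    finally have "n^92 \<le> 4^13 * 10368 * 1024^6 * u^91"
      by (simp add: mult.assoc flip: power_mult power_add)
    then have "n^92 * n^9 \<le> 4^13 * 10368 * 1024^6 * u^91 * u^9"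
      by (rule mult_mono[OF _ power_mono[OF un]]) (use n u in auto)
    then have "n^101 \<le> 4^13 * 10368 * 1024^6 * u^100" by (simp add: mult.assoc flip: power_add)
    also have "\<dots> \<le> 10^40 * u^100" using u by (intro mult_right_mono) auto
    finally show ?thesis .
  next
    assume "m^13 \<le> 10368 * k^5 * \<Delta>^7"
    also have "\<dots> \<le> 10368 * v^5 * \<Delta>^7" using kv v0 by (intro mult_right_mono mult_left_mono power_mono) auto
    finally have mm: "m^13 \<le> 10368 * v^5 * \<Delta>^7" .
    have "(n^2)^13 \<le> (4 * u * m)^13" using m1 by (intro power_mono) auto
    also have "\<dots> = 4^13 * u^13 * m^13" by (simp add: power_mult_distrib)
    also have "\<dots> \<le> 4^13 * u^13 * (10368 * v^5 * \<Delta>^7)" using mm u by (intro mult_left_mono) auto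
    \<comment> \<open>The same completion, now with \<open>(v * n)^33\<close>. The exponents become
      \<open>26 + 42 + 33 = 101\<close> for \<open>n\<close> and \<open>34 + 66 = 100\<close> for
      \<open>u\<close>, which fixes the exponent of the lemma.\<close>
    finally have "(n^2)^13 * (n^6)^7 * n^33 \<le> 4^13 * u^13 * (10368 * v^5 * \<Delta>^7) * (n^6)^7 * n^33"
      using n by (intro mult_right_mono) auto
    also have "\<dots> = 4^13 * 10368 * u^13 * v^5 * (\<Delta> * n^6)^7 * n^33" by (simp add: power_mult_distrib mult_ac)
    also have "\<dots> \<le> 4^13 * 10368 * u^13 * v^5 * (1024 * u^3 * v^4)^7 * n^33"
      using d1 v0 u n by (intro mult_right_mono mult_left_mono power_mono) auto
    also have "\<dots> = 4^13 * 10368 * 1024^7 * u^34 * (v * n)^33"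
    proof -
      have "(1024 * u^3 * v^4)^7 = 1024^7 * u^21 * v^28"
        by (simp only: power_mult_distrib flip: power_mult) simp
      moreover have "u^34 = u^13 * u^21" "v^33 = v^5 * v^28" by (simp_all flip: power_add)
      ultimately show ?thesis by (simp only: power_mult_distrib mult_ac)
    qed
    also have "\<dots> \<le> 4^13 * 10368 * 1024^7 * u^34 * (u^2)^33"
      using vn v0 n u by (intro mult_left_mono power_mono) auto
    finally have "n^101 \<le> 4^13 * 10368 * 1024^7 * u^100"
      by (simp add: mult.assoc flip: power_mult power_add)
    also have "\<dots> \<le> 10^40 * u^100" using u by (intro mult_right_mono) auto
    finally show ?thesis .
  qed
  then show ?thesis by (simp add: n_def u_def U_def B_def D_def)
qed simp

end

section \<open>Transfer to the residue rings\<close>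

text \<open>The product of all residue rings: a single ring type that contains every prime field, so
  that the type class lemmas apply for a variable prime. The factor at \<open>p = 0\<close> is \<open>\<int>\<close>,
  since \<open>x mod 0 = x\<close>.\<close>

typedef residue_family = "{f :: nat \<Rightarrow> int. \<forall>p. f p mod int p = f p}"
  by (rule exI[of _ "\<lambda>_. 0"]) simp

setup_lifting type_definition_residue_family

instantiation residue_family :: comm_ring_1
begin

lift_definition zero_residue_family :: residue_family is "\<lambda>_. 0" by simp
lift_definition one_residue_family :: residue_family is "\<lambda>p. 1 mod int p" by simp
lift_definition plus_residue_family :: "residue_family \<Rightarrow> residue_family \<Rightarrow> residue_family"
  is "\<lambda>f g p. (f p + g p) mod int p" by simp
lift_definition minus_residue_family :: "residue_family \<Rightarrow> residue_family \<Rightarrow> residue_family"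
  is "\<lambda>f g p. (f p - g p) mod int p" by simp
lift_definition uminus_residue_family :: "residue_family \<Rightarrow> residue_family"
  is "\<lambda>f p. (- f p) mod int p" by simp
lift_definition times_residue_family :: "residue_family \<Rightarrow> residue_family \<Rightarrow> residue_family"
  is "\<lambda>f g p. (f p * g p) mod int p" by simp

instance
proof
  show "(0::residue_family) \<noteq> 1"
    by transfer (metis mod_by_0 of_nat_0 zero_neq_one)
qed (transfer, auto simp: fun_eq_iff mod_simps algebra_simps)+

end

section \<open>The copy of the integers modulo \<open>p\<close> in the product ring\<close>

text \<open>Supported on the single coordinate \<open>p\<close>, so \<open>residue_at p 1\<close> is
  an idempotent different from the unit of the product ring; hence the separate unit
  \<open>e\<close> in \<open>prime_subfield\<close>.\<close>

lift_definition residue_at :: "nat \<Rightarrow> int \<Rightarrow> residue_family" is "\<lambda>p x q. if q = p then x mod int p else 0"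
  by simp

lemma residue_at_zero [simp]: "residue_at p 0 = 0"
  by transfer auto

lemma residue_at_add: "residue_at p (x + y) = residue_at p x + residue_at p y"
  by transfer (auto simp: fun_eq_iff mod_simps)

lemma residue_at_diff: "residue_at p (x - y) = residue_at p x - residue_at p y"
  by transfer (auto simp: fun_eq_iff mod_simps)

lemma residue_at_mult: "residue_at p (x * y) = residue_at p x * residue_at p y"
  by transfer (auto simp: fun_eq_iff mod_simps)

lemma residue_at_eq_iff: "residue_at p x = residue_at p y \<longleftrightarrow> x mod int p = y mod int p"
  by transfer (auto simp: fun_eq_iff)

lemma residue_at_mod [simp]: "residue_at p (x mod int p) = residue_at p x"
  by (simp add: residue_at_eq_iff)

lemma residue_at_eq_0_iff: "residue_at p x = 0 \<longleftrightarrow> int p dvd x"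
  using residue_at_eq_iff[of p x 0] by (simp add: dvd_eq_mod_eq_0)

lemma residue_at_range:
  assumes "p > 0"
  shows "range (residue_at p) = residue_at p ` {0..<int p}"
proof -
  have "residue_at p x \<in> residue_at p ` {0..<int p}" for x
    using assms by (intro image_eqI[of _ _ "x mod int p"]) auto
  then show ?thesis by auto
qed

lemma card_range_residue_at:
  assumes "p > 0"
  shows "card (range (residue_at p)) = p"
proof -
  have "inj_on (residue_at p) {0..<int p}" by (auto simp: inj_on_def residue_at_eq_iff)
  then show ?thesis using residue_at_range[OF assms] by (simp add: card_image)
qed

lemma prime_subfield_residue_at:
  assumes p: "prime p"
  shows "prime_subfield (range (residue_at p)) (residue_at p 1)"
proof
  have p0: "p > 0" using p by (simp add: prime_gt_0_nat)
  show "finite (range (residue_at p))" using residue_at_range[OF p0] by simp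
  show "0 \<in> range (residue_at p)" by (metis residue_at_zero rangeI)
  fix x y assume x: "x \<in> range (residue_at p)"
  then obtain i where i: "x = residue_at p i" by blast
  show "residue_at p 1 * x = x" by (simp add: i flip: residue_at_mult)
  show "\<exists>y\<in>range (residue_at p). x * y = residue_at p 1" if "x \<noteq> 0"
  proof -
    have "\<not> int p dvd i" using that by (simp add: i residue_at_eq_0_iff)
    then have "coprime i (int p)"
      using p by (metis coprime_commute prime_imp_coprime prime_nat_int_transfer)
    then obtain j where "[i * j = 1] (mod int p)" using cong_solve_coprime_int by blast
    then have "x * residue_at p j = residue_at p 1"
      by (simp add: i cong_def residue_at_eq_iff flip: residue_at_mult)
    then show ?thesis by blast
  qed
  assume y: "y \<in> range (residue_at p)"
  then obtain j where j: "y = residue_at p j" by blast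
  show "x - y \<in> range (residue_at p)" "x * y \<in> range (residue_at p)"
    by (auto simp: i j simp flip: residue_at_diff residue_at_mult)
next
  have p0: "p > 0" using p by (simp add: prime_gt_0_nat)
  show "residue_at p 1 \<in> range (residue_at p)" by blast
  fix R assume R: "0 \<in> R" "\<And>x. x \<in> R \<Longrightarrow> x - residue_at p 1 \<in> R"
  \<comment> \<open>Subtracting the unit repeatedly from 0 reaches only negatives of natural
    numbers, but modulo \<open>p\<close> these are all residues.\<close>
  have neg: "residue_at p (- int k) \<in> R" for k
  proof (induction k)
    case (Suc k)
    have "- int (Suc k) = - int k - 1" by simp
    then have "residue_at p (- int (Suc k)) = residue_at p (- int k) - residue_at p 1"
      by (simp only: residue_at_diff)
    then show ?case using R(2)[OF Suc] by simp
  qed (use R in simp)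
  show "range (residue_at p) \<subseteq> R"
  proof clarify
    fix i
    have "residue_at p i = residue_at p (- int (nat ((- i) mod int p)))"
      using p0 by (simp add: residue_at_eq_iff mod_simps)
    then show "residue_at p i \<in> R" using neg by metis
  qed
qed

section \<open>Return to the residue ring and the final bound\<close>

lemma finite_shifted_ratio_set:
  assumes "finite A"
  shows "finite (shifted_ratio_set R A)"
proof -
  have "shifted_ratio_set R A = (\<lambda>(a, b). (a \<oplus>\<^bsub>R\<^esub> \<one>\<^bsub>R\<^esub>) \<otimes>\<^bsub>R\<^esub> inv\<^bsub>R\<^esub> b) ` (A \<times> A)"
    by (auto simp: shifted_ratio_set_def)
  then show ?thesis using assms by simp
qed

text \<open>By cancellation \<open>residue_at p\<close> carries \<open>inv\<close> of the residue
  ring to \<open>E.recip\<close> on \<open>A\<close>. The ratio set in the embedded field therefore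
  lies in an image of \<open>shifted_ratio_set\<close>, which is no larger than the set itself. The
  excluded residue \<open>int p - 1\<close> is the class of -1.\<close>

lemma card_shifted_ratio_set_ge:
  assumes p: "prime p" and A: "A \<subseteq> {1..<int p}" "int p - 1 \<notin> A" and small: "card A ^ 2 \<le> p"
  shows "real (card A) ^ 101 \<le> 10^40 * real (card (shifted_ratio_set (residue_ring (int p)) A)) ^ 100"
proof -
  let ?R = "residue_ring (int p)"
  interpret res: residues_prime p ?R by unfold_locales (use p in auto)
  interpret E: prime_subfield "range (residue_at p)" "residue_at p 1" by (rule prime_subfield_residue_at[OF p])
  have p0: "p > 0" using p by (simp add: prime_gt_0_nat)
  have finA: "finite A" using A finite_subset by blast
  have "a mod int p = a" if "a \<in> A" for a using A(1) that by auto
  then have inj: "inj_on (residue_at p) A" by (auto simp: inj_on_def residue_at_eq_iff)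
  have nz: "residue_at p a \<in> range (residue_at p) - {0}" if "a \<in> A" for a
    using A that zdvd_not_zless[of a "int p"] by (auto simp: residue_at_eq_0_iff)
  have small': "card (residue_at p ` A) ^ 2 \<le> card (range (residue_at p))"
    using small by (simp add: card_image[OF inj] card_range_residue_at[OF p0])
  have minus: "- residue_at p 1 \<notin> residue_at p ` A"
  proof
    assume "- residue_at p 1 \<in> residue_at p ` A"
    then obtain a where a: "a \<in> A" "residue_at p a = - residue_at p 1" by auto
    then have "residue_at p (a + 1) = 0" by (simp add: residue_at_add)
    then have "int p dvd a + 1" by (simp add: residue_at_eq_0_iff)
    moreover have "1 \<le> a" "a < int p" using A(1) a(1) by auto
    ultimately have "a = int p - 1" using zdvd_imp_le[of "int p" "a + 1"] by linarith
    then show False using A(2) a(1) by blast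
  qed
  have "(\<lambda>a. a + residue_at p 1) ` residue_at p ` A * E.recip ` residue_at p ` A \<subseteq> residue_at p ` shifted_ratio_set ?R A"
  proof
    fix z assume "z \<in> (\<lambda>a. a + residue_at p 1) ` residue_at p ` A * E.recip ` residue_at p ` A"
    then obtain a b where ab: "a \<in> A" "b \<in> A" "z = (residue_at p a + residue_at p 1) * E.recip (residue_at p b)"
      by (auto elim!: set_times_elim)
    have b: "b \<in> carrier ?R" "b \<noteq> \<zero>\<^bsub>?R\<^esub>"
      using ab A by (auto simp: res.res_carrier_eq res.res_zero_eq subset_iff)
    then have "b \<in> Units ?R" using res.is_field field.field_Units by blast
    then have "b \<otimes>\<^bsub>?R\<^esub> inv\<^bsub>?R\<^esub> b = \<one>\<^bsub>?R\<^esub>" by (rule res.Units_r_inv)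
    then have "(b * inv\<^bsub>?R\<^esub> b) mod int p = 1" by (simp add: res.res_mult_eq res.res_one_eq)
    then have "residue_at p (b * inv\<^bsub>?R\<^esub> b) = residue_at p 1" by (metis residue_at_mod)
    then have inv: "residue_at p b * residue_at p (inv\<^bsub>?R\<^esub> b) = residue_at p b * E.recip (residue_at p b)"
      using E.recip(2)[OF nz[OF ab(2)]] by (simp add: residue_at_mult)
    then have "residue_at p (inv\<^bsub>?R\<^esub> b) = E.recip (residue_at p b)"
      using E.mult_cancel[OF nz[OF ab(2)] _ _ inv] E.recip(1)[OF nz[OF ab(2)]] by blast
    then have "z = residue_at p ((a \<oplus>\<^bsub>?R\<^esub> \<one>\<^bsub>?R\<^esub>) \<otimes>\<^bsub>?R\<^esub> inv\<^bsub>?R\<^esub> b)"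
      by (simp add: ab(3) res.res_add_eq res.res_mult_eq res.res_one_eq residue_at_add residue_at_mult)
    then show "z \<in> residue_at p ` shifted_ratio_set ?R A"
      using ab by (auto simp: shifted_ratio_set_def)
  qed
  moreover have fin: "finite (shifted_ratio_set ?R A)"
    by (rule finite_shifted_ratio_set[OF finA])
  ultimately have "card ((\<lambda>a. a + residue_at p 1) ` residue_at p ` A * E.recip ` residue_at p ` A) \<le> card (shifted_ratio_set ?R A)"
    by (meson card_image_le card_mono finite_imageI order_trans)
  then have "10^40 * real (card ((\<lambda>a. a + residue_at p 1) ` residue_at p ` A * E.recip ` residue_at p ` A)) ^ 100
      \<le> 10^40 * real (card (shifted_ratio_set ?R A)) ^ 100"
    by (intro mult_left_mono power_mono) auto
  moreover have "real (card (residue_at p ` A)) ^ 101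
      \<le> 10^40 * real (card ((\<lambda>a. a + residue_at p 1) ` residue_at p ` A * E.recip ` residue_at p ` A)) ^ 100"
    using nz minus small' by (intro E.shifted_ratio_growth) auto
  ultimately have "real (card (residue_at p ` A)) ^ 101 \<le> 10^40 * real (card (shifted_ratio_set ?R A)) ^ 100"
    by (rule order_trans[rotated])
  then show ?thesis by (simp only: card_image[OF inj])
qed

theorem theorem3p4:
  shows "\<exists>c::real. c > 0 \<and>
    (\<forall>(p::nat) (A::int set).
       prime p \<longrightarrow>
       A \<subseteq> carrier (residue_ring (int p)) - {\<zero>\<^bsub>residue_ring (int p)\<^esub>} \<longrightarrow>
       real (card A) \<le> real p powr (1/2) \<longrightarrow>
       real (card (shifted_ratio_set (residue_ring (int p)) A)) \<ge> c * real (card A) powr (110/109))"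
proof (intro exI[of _ "1/100"] conjI allI impI)
  fix p :: nat and A :: "int set"
  let ?R = "residue_ring (int p)"
  assume p: "prime p" and A: "A \<subseteq> carrier ?R - {\<zero>\<^bsub>?R\<^esub>}" and small: "real (card A) \<le> real p powr (1/2)"
  interpret res: residues_prime p ?R by unfold_locales (use p in auto)
  have A': "A \<subseteq> {1..<int p}"
    using A by (fastforce simp: res.res_carrier_eq res.res_zero_eq)
  have finA: "finite A" using A' finite_subset by blast
  define n s where "n = real (card A)" and "s = real (card (shifted_ratio_set ?R A))"
  have fin: "finite (shifted_ratio_set ?R A)"
    by (rule finite_shifted_ratio_set[OF finA])
  have "n^2 \<le> (real p powr (1/2))^2" using small by (intro power_mono) (auto simp: n_def)
  then have "n^2 \<le> real p" by (simp add: powr_half_sqrt)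
  then have "real (card A ^ 2) \<le> real p" by (simp add: n_def)
  then have small_nat: "card A ^ 2 \<le> p" by (simp only: of_nat_le_iff)
  have "1/100 * n powr (110/109) \<le> s"
  proof -
    consider "card A = 0" | "card A = 1" | "card A \<ge> 2" by linarith
    then show ?thesis
    proof cases
      case 1
      then show ?thesis by (simp add: n_def s_def)
    next
      \<comment> \<open>Singletons are separate because deleting the class of -1 below could leave
        the empty set.\<close>
      case 2
      then obtain a where "A = {a}" by (auto simp: card_1_singleton_iff)
      then have "shifted_ratio_set ?R A \<noteq> {}" by (auto simp: shifted_ratio_set_def)
      then have "card (shifted_ratio_set ?R A) > 0" using fin by (simp add: card_gt_0_iff)
      then have "s \<ge> 1" unfolding s_def by linarith
      then show ?thesis using 2 by (simp add: n_def)
    next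
      case 3
      \<comment> \<open>The class of -1 is deleted because adding 1 sends it to 0. As
        \<open>n \<ge> 2\<close>, at least half of \<open>A\<close> remains.\<close>
      define A1 where "A1 = A - {int p - 1}"
      have sub: "A1 \<subseteq> A" by (auto simp: A1_def)
      have "card A1 = card A - 1 \<or> card A1 = card A" by (simp add: A1_def card_Diff_singleton_if)
      then have "card A \<le> Suc (card A1)" by linarith
      then have n1: "n / 2 \<le> real (card A1)" using 3 by (simp add: n_def)
      have "card A1 \<le> card A" by (rule card_mono[OF finA sub])
      then have "card A1 ^ 2 \<le> p" using small_nat by (meson order_trans power_mono zero_le)
      then have "real (card A1) ^ 101 \<le> 10^40 * real (card (shifted_ratio_set ?R A1)) ^ 100"
        using p A' sub by (intro card_shifted_ratio_set_ge) (auto simp: A1_def)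
      also have "card (shifted_ratio_set ?R A1) \<le> card (shifted_ratio_set ?R A)"
        by (rule card_mono[OF fin]) (use sub in \<open>auto simp: shifted_ratio_set_def\<close>)
      then have "10^40 * real (card (shifted_ratio_set ?R A1)) ^ 100 \<le> 10^40 * s ^ 100"
        by (intro mult_left_mono power_mono) (auto simp: s_def)
      finally have main: "real (card A1) ^ 101 \<le> 10^40 * s^100" .
      have n0: "n \<ge> 2" using 3 by (simp add: n_def)
      have "(n / 2)^101 \<le> real (card A1) ^ 101" using n1 n0 by (intro power_mono) auto
      with main have "(n / 2)^101 \<le> 10^40 * s^100" by linarith
      then have "n^101 \<le> 2^101 * 10^40 * s^100" by (simp add: power_divide)
      \<comment> \<open>The generous constant \<open>100^100\<close> is a perfect 100th power, so
        taking 100th roots leaves the factor 100.\<close>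
      also have "\<dots> \<le> 100^100 * s^100" by (intro mult_right_mono) (auto simp: s_def)
      also have "\<dots> = (100 * s)^100" by (simp only: power_mult_distrib)
      finally have "n^101 \<le> (100 * s)^100" .
      moreover have "(n powr (101/100))^100 = n powr real 101"
        using n0 by (simp add: powr_power)
      then have "(n powr (101/100))^100 = n^101"
        using n0 by (simp only: powr_realpow)
      ultimately have "(n powr (101/100))^100 \<le> (100 * s)^100" by simp
      then have "n powr (101/100) \<le> 100 * s"
        by (rule power_le_imp_le_base[of _ 99, simplified]) (simp add: s_def)
      \<comment> \<open>\<open>110/109\<close> is smaller than \<open>101/100\<close>, and
        \<open>n \<ge> 1\<close>.\<close>
      moreover have "n powr (110/109) \<le> n powr (101/100)"
        using n0 by (intro powr_mono) auto
      ultimately show ?thesis by simp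
    qed
  qed
  then show "real (card (shifted_ratio_set ?R A)) \<ge> 1/100 * real (card A) powr (110/109)"
    by (simp add: n_def s_def)
qed simp

end
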